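(* Let $d\ge 0$ and $0\le k\le d$ be integers, let $V_1,\ldots,V_{d+1}$ be pairwise disjoint finite sets, and put $V=V_1\sqcup\cdots\sqcup V_{d+1}$. Let $T\subseteq V_1*\cdots*V_{k+1}$ be a spanning $k$-tree. If $A:|\Delta_V|\to\mathbb R^d$ is a colorful Carathéodory map, then there exists a face $\sigma\in T*V_{k+2}*\cdots*V_{d+1}$ such that $0\in A(\sigma)$.
   Context: An abstract simplicial complex is a family of finite subsets (faces) of a ground set that is closed under taking subsets and contains $\varnothing$; the dimension of a face is its cardinality minus $1$; a facet is an inclusion-maximal face. For a finite set $V$, $\Delta_V:=2^V$ is the full simplex on $V$. For complexes $K,L$ on disjoint vertex sets the join is $K*L=\{\sigma\cup\tau:\sigma\in K,\ \tau\in L\}$. When a finite set appears in a join, it is regarded as the $0$-dimensional complex whose nonempty faces are its one-point subsets; thus $V_1*\cdots*V_m$ is the complex of all subsets of $V_1\sqcup\cdots\sqcup V_m$ containing at most one element of each $V_i$. For a complex $K$ on a finite vertex set $V$, each vertex $v$ is placed at the standard basis vector $e_v\in\mathbb R^V$; for $\sigma\in K$, $|\sigma|=\operatorname{conv}\{e_v:v\in\sigma\}$, $|\sigma|^\circ$ is its relative interior (the open simplex: points whose support is exactly $\sigma$), and $|K|=\bigsqcup_{\sigma\in K}|\sigma|^\circ$. A map $A:|K|\to\mathbb R^d$ is affine if it is the affine extension over each face of its values on the vertices. For $\sigma\in K$ one writes $A(\sigma):=A(|\sigma|^\circ)$. An affine map $A:|\Delta_V|\to\mathbb R^d$, where $V=V_1\sqcup\cdots\sqcup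 V_{d+1}$, is a colorful Carathéodory map if $0\in A(V_i)$ for every $i=1,\dots,d+1$; here $V_i$ is regarded as a face of $\Delta_V$, so $A(V_i)=A(|V_i|^\circ)$. A finite simplicial complex is a $k$-sphere if its geometric realization is homeomorphic to $S^k$. A complex contains a $k$-sphere if it has a subcomplex that is a $k$-sphere. A subcomplex $T\subseteq V_1*\cdots*V_{k+1}$ is a spanning $k$-tree if it contains all faces of $V_1*\cdots*V_{k+1}$ of dimension at most $k-1$ and: (1) $T$ contains no $k$-spheres; (2) for every facet $\sigma$ of $V_1*\cdots*V_{k+1}$ that does not belong to $T$, the complex $T\cup\{\sigma\}$ contains a unique $k$-sphere. *)

theory Defs
  imports "HOL-Analysis.Analysis"
begin

definition abstract_simplicial_complex :: "'a set set \<Rightarrow> bool" where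
  "abstract_simplicial_complex K \<longleftrightarrow>
     {} \<in> K \<and> (\<forall>\<sigma>\<in>K. finite \<sigma>) \<and> (\<forall>\<sigma>\<in>K. \<forall>\<tau>. \<tau> \<subseteq> \<sigma> \<longrightarrow> \<tau> \<in> K)"

definition subcomplex :: "'a set set \<Rightarrow> 'a set set \<Rightarrow> bool" where
  "subcomplex L K \<longleftrightarrow> abstract_simplicial_complex L \<and> L \<subseteq> K"

definition face_dim :: "'a set \<Rightarrow> int" where
  "face_dim \<sigma> = int (card \<sigma>) - 1"

definition facet :: "'a set set \<Rightarrow> 'a set \<Rightarrow> bool" where
  "facet K \<sigma> \<longleftrightarrow> \<sigma> \<in> K \<and> (\<forall>\<tau>\<in>K. \<sigma> \<subseteq> \<tau> \<longrightarrow> \<tau> = \<sigma>)"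

abbreviation full_simplex :: "'a set \<Rightarrow> 'a set set" where
  "full_simplex V \<equiv> Pow V"

definition complex_join :: "'a set set \<Rightarrow> 'a set set \<Rightarrow> 'a set set" where
  "complex_join K L = {\<sigma> \<union> \<tau> | \<sigma> \<tau>. \<sigma> \<in> K \<and> \<tau> \<in> L}"

definition points_complex :: "'a set \<Rightarrow> 'a set set" where
  "points_complex W = insert {} {{v} | v. v \<in> W}"

text \<open>The join of a list of complexes; the empty join is the complex whose only face is the
  empty set, which is neutral for the join.\<close>

definition joins :: "'a set set list \<Rightarrow> 'a set set" where
  "joins Ks = foldr complex_join Ks {{}}"

lemma complex_join_neutral [simp]: "complex_join K {{}} = K"
  by (auto simp: complex_join_def)

lemma joins_points_complex:
  assumes "distinct is"
    and "\<And>i j. i \<in> set is \<Longrightarrow> j \<in> set is \<Longrightarrow> i \<noteq> j \<Longrightarrow> V i \<inter> V j = {}"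
  shows "joins (map (\<lambda>i. points_complex (V i)) is) =
    {\<sigma>. \<sigma> \<subseteq> (\<Union>i\<in>set is. V i) \<and> (\<forall>i\<in>set is. \<sigma> \<inter> V i = {} \<or> (\<exists>v. \<sigma> \<inter> V i = {v}))}"
  using assms
proof (induction "is")
  case Nil
  then show ?case by (auto simp: joins_def)
next
  case (Cons i "is")
  let ?C = "\<lambda>js. {\<sigma>. \<sigma> \<subseteq> (\<Union>i\<in>set js. V i) \<and>
                   (\<forall>i\<in>set js. \<sigma> \<inter> V i = {} \<or> (\<exists>v. \<sigma> \<inter> V i = {v}))}"
  have IH: "joins (map (\<lambda>i. points_complex (V i)) is) = ?C is"
    using Cons.prems by (intro Cons.IH) auto
  have dj: "V i \<inter> V j = {}" if "j \<in> set is" for j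
    using Cons.prems that by (metis distinct.simps(2) list.set_intros)
  have "joins (map (\<lambda>i. points_complex (V i)) (i # is)) =
          complex_join (points_complex (V i)) (?C is)"
    using IH by (simp add: joins_def)
  also have "\<dots> = ?C (i # is)"
  proof (intro set_eqI iffI)
    fix \<sigma> assume "\<sigma> \<in> complex_join (points_complex (V i)) (?C is)"
    then obtain \<alpha> \<tau> where s: "\<sigma> = \<alpha> \<union> \<tau>" "\<alpha> \<in> points_complex (V i)" "\<tau> \<in> ?C is"
      by (auto simp: complex_join_def)
    have a: "\<alpha> \<subseteq> V i" "\<alpha> = {} \<or> (\<exists>v. \<alpha> = {v})"
      using s(2) by (auto simp: points_complex_def)
    have t: "\<tau> \<subseteq> (\<Union>i\<in>set is. V i)" using s(3) by simp
    have "\<sigma> \<inter> V i = \<alpha>" using s(1) a(1) t dj by blast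
    moreover have "\<sigma> \<inter> V j = \<tau> \<inter> V j" if "j \<in> set is" for j
      using s(1) a(1) dj[OF that] by blast
    moreover have "\<sigma> \<subseteq> (\<Union>i\<in>set (i # is). V i)" using s(1) a(1) t by auto
    ultimately show "\<sigma> \<in> ?C (i # is)" using a(2) s(3) by simp
  next
    fix \<sigma> assume s: "\<sigma> \<in> ?C (i # is)"
    define \<tau> where "\<tau> = \<sigma> - V i"
    have "\<tau> \<inter> V j = \<sigma> \<inter> V j" if "j \<in> set is" for j
      using dj[OF that] by (auto simp: \<tau>_def)
    moreover have "\<tau> \<subseteq> (\<Union>i\<in>set is. V i)" using s by (auto simp: \<tau>_def)
    ultimately have "\<tau> \<in> ?C is" using s by simp
    moreover have "\<sigma> \<inter> V i \<in> points_complex (V i)"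
      using s by (auto simp: points_complex_def)
    moreover have "\<sigma> = (\<sigma> \<inter> V i) \<union> \<tau>" by (auto simp: \<tau>_def)
    ultimately show "\<sigma> \<in> complex_join (points_complex (V i)) (?C is)"
      unfolding complex_join_def by blast
  qed
  finally show ?case .
qed

text \<open>Coordinates are indexed by the whole vertex type.  For a finite vertex set \<open>V\<close>, the space
  \<open>\<real>\<^sup>V\<close> is identified with the functions vanishing outside \<open>V\<close>, so that the realization of a
  complex does not depend on the choice of a ground set.\<close>

definition basis_vector :: "'a \<Rightarrow> 'a \<Rightarrow> real" where
  "basis_vector v = (\<lambda>w. if w = v then 1 else 0)"

text \<open>The convex hull of the basis vectors of the vertices of a finite set, written out as the set
  of convex combinations because function spaces over an arbitrary type carry no vector space
  instance.\<close>

definition simplex_of :: "'a set \<Rightarrow> ('a \<Rightarrow> real) set" where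
  "simplex_of \<sigma> =
     {(\<lambda>w. \<Sum>v\<in>\<sigma>. c v * basis_vector v w) | c. (\<forall>v\<in>\<sigma>. 0 \<le> c v) \<and> (\<Sum>v\<in>\<sigma>. c v) = 1}"

lemma simplex_of_iff:
  assumes "finite \<sigma>"
  shows "x \<in> simplex_of \<sigma> \<longleftrightarrow>
           (\<forall>v. 0 \<le> x v) \<and> (\<forall>v. v \<notin> \<sigma> \<longrightarrow> x v = 0) \<and> (\<Sum>v\<in>\<sigma>. x v) = 1"
proof -
  have comb: "(\<Sum>v\<in>\<sigma>. c v * basis_vector v w) = (if w \<in> \<sigma> then c w else 0)" for c w
    using assms by (simp add: basis_vector_def if_distrib cong: if_cong)
  show ?thesis (is "_ \<longleftrightarrow> ?R")
  proof
    assume "x \<in> simplex_of \<sigma>"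
    then obtain c where "x = (\<lambda>w. if w \<in> \<sigma> then c w else 0)"
      and "\<forall>v\<in>\<sigma>. 0 \<le> c v" "(\<Sum>v\<in>\<sigma>. c v) = 1"
      by (auto simp: simplex_of_def comb)
    then show ?R by auto
  next
    assume R: ?R
    then have "x = (\<lambda>w. if w \<in> \<sigma> then x w else 0)" by auto
    with R show "x \<in> simplex_of \<sigma>"
      unfolding simplex_of_def comb by blast
  qed
qed

definition open_simplex :: "'a set \<Rightarrow> ('a \<Rightarrow> real) set" where
  "open_simplex \<sigma> = {x \<in> simplex_of \<sigma>. {v. x v \<noteq> 0} = \<sigma>}"

definition realization :: "'a set set \<Rightarrow> ('a \<Rightarrow> real) set" where
  "realization K = (\<Union>\<sigma>\<in>K. open_simplex \<sigma>)"

definition realization_top :: "'a set set \<Rightarrow> ('a \<Rightarrow> real) topology" where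
  "realization_top K = subtopology (powertop_real UNIV) (realization K)"

definition sphere_complex :: "nat \<Rightarrow> 'a set set \<Rightarrow> bool" where
  "sphere_complex k K \<longleftrightarrow>
     abstract_simplicial_complex K \<and> finite K \<and> realization_top K homeomorphic_space nsphere k"

definition spanning_tree :: "nat \<Rightarrow> (nat \<Rightarrow> 'a set) \<Rightarrow> 'a set set \<Rightarrow> bool" where
  "spanning_tree k V T \<longleftrightarrow>
     (let J = joins (map (\<lambda>i. points_complex (V i)) [1..<k + 2]) in
        subcomplex T J \<and>
        (\<forall>\<sigma>\<in>J. face_dim \<sigma> \<le> int k - 1 \<longrightarrow> \<sigma> \<in> T) \<and>
        \<not> (\<exists>S. subcomplex S T \<and> sphere_complex k S) \<and>
        (\<forall>\<sigma>. facet J \<sigma> \<and> \<sigma> \<notin> T \<longrightarrow>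
           (\<exists>!S. subcomplex S (T \<union> {\<sigma>}) \<and> sphere_complex k S)))"

text \<open>As in the library, \<open>\<real>\<^sup>d\<close> is the set of sequences vanishing from index \<open>d\<close> on, which
  includes the one-point space for \<open>d = 0\<close>.\<close>

definition affine_map :: "'a set set \<Rightarrow> nat \<Rightarrow> (('a \<Rightarrow> real) \<Rightarrow> nat \<Rightarrow> real) \<Rightarrow> bool" where
  "affine_map K d A \<longleftrightarrow>
     A ` realization K \<subseteq> topspace (Euclidean_space d) \<and>
     (\<forall>\<sigma>\<in>K. \<forall>x\<in>simplex_of \<sigma>. A x = (\<lambda>j. \<Sum>v\<in>\<sigma>. x v * A (basis_vector v) j))"

definition face_image :: "(('a \<Rightarrow> real) \<Rightarrow> nat \<Rightarrow> real) \<Rightarrow> 'a set \<Rightarrow> (nat \<Rightarrow> real) set" where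
  "face_image A \<sigma> = A ` open_simplex \<sigma>"

definition colorful_Caratheodory_map ::
  "nat \<Rightarrow> (nat \<Rightarrow> 'a set) \<Rightarrow> (('a \<Rightarrow> real) \<Rightarrow> nat \<Rightarrow> real) \<Rightarrow> bool" where
  "colorful_Caratheodory_map d V A \<longleftrightarrow>
     affine_map (full_simplex (\<Union>i\<in>{1..d + 1}. V i)) d A \<and>
     (\<forall>i\<in>{1..d + 1}. (\<lambda>_. 0) \<in> face_image A (V i))"

end

(* For a facet s of V_1 * ... * V_{k+1} outside T, the k-sphere in T + s contains s.  A sphere minus
   a point is contractible, so s can be mapped into T relative to its boundary.  Hence |T| is a
   retract of |V_1 * ... * V_{k+1}|, and |T * V_{k+2} * ... * V_{d+1}| is the image of a retraction Q
   of |V_1 * ... * V_{d+1}| that fixes every point with at most k vertices in the first k+1 classes.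
   A fine subdivision of a d-cube whose vertices carry d+1 colours, all distinct on every simplex,
   with one colour missing on the boundary, yields a map g from the cube to |V_1 * ... * V_{d+1}|:
   since 0 lies in every A(V_i), a vertex y of colour i can be sent to some v in V_i with
   <y - c, A v> <= 0, where c is the centre of the cube.  Give V_{k+1} the colour missing on the
   boundary.  Then A o Q o g equals A o g on the boundary and is not outward pointing there, up to an
   arbitrarily small error, so it has a zero by Brouwer's theorem. *)

theory Submission
  imports Defs
begin

text \<open>The inequalities obtained from 0 lying in every A(V_i) constrain A o g but not A o Q o
  g, since Q is merely continuous and may move interior points anywhere. This is harmless because
  Brouwer's theorem asks for them on the boundary alone. Any of the first k+1 classes could carry
  the missing colour: a boundary point then meets at most k of them, so its part there is a face of
  dimension at most k-1 and belongs to every spanning tree. The sphere in T + s must use s because T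
  itself contains no k-sphere. The error of a finite mesh is absorbed by arguing by contradiction:
  without a zero, compactness keeps the l1 norm of A o Q above some \<delta> > 0 that is fixed
  before the mesh is chosen.\<close>

subsection \<open>Continuity in function spaces\<close>

lemma continuous_on_coord:
  fixes f :: "'a::topological_space \<Rightarrow> 'b \<Rightarrow> real"
  assumes "continuous_on S f"
  shows "continuous_on S (\<lambda>x. f x i)"
  using assms by (rule continuous_on_product_then_coordinatewise)

lemma continuous_on_coordinate: "continuous_on S (\<lambda>x :: 'b \<Rightarrow> real. x i)"
  by (rule continuous_on_subset[OF continuous_on_product_coordinates subset_UNIV])

lemma tendsto_coordinatewise:
  fixes f :: "'a \<Rightarrow> 'b \<Rightarrow> real"
  shows "(f \<longlongrightarrow> l) F \<longleftrightarrow> (\<forall>i. ((\<lambda>x. f x i) \<longlongrightarrow> l i) F)"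
  using limitin_componentwise[of "\<lambda>_. euclideanreal" UNIV f l F]
  by (simp add: euclidean_product_topology)

text \<open>Where \<open>s\<close> vanishes, \<open>f\<close> may jump or be a meaningless quotient:
  nearby the product is bounded by |s|. Serves wherever a construction degenerates together with its
  weight: cone coordinates at a barycentre, an empty join factor, vertex choices that are only
  locally constant.\<close>

lemma continuous_on_scaled:
  fixes s f :: "'a::topological_space \<Rightarrow> real"
  assumes s: "continuous_on X s"
    and f: "continuous_on {x \<in> X. s x \<noteq> 0} f"
    and bd: "\<And>x. x \<in> X \<Longrightarrow> s x \<noteq> 0 \<Longrightarrow> \<bar>f x\<bar> \<le> 1"
  shows "continuous_on X (\<lambda>x. s x * f x)"
  unfolding continuous_on_def
proof
  fix x assume x: "x \<in> X"
  have sx: "(s \<longlongrightarrow> s x) (at x within X)"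
    using s x by (auto simp: continuous_on_def)
  show "((\<lambda>x. s x * f x) \<longlongrightarrow> s x * f x) (at x within X)"
  proof (cases "s x = 0")
    case True
    have "((\<lambda>x. s x * f x) \<longlongrightarrow> 0) (at x within X)"
    proof (rule Lim_null_comparison)
      show "\<forall>\<^sub>F y in at x within X. norm (s y * f y) \<le> \<bar>s y\<bar>"
        unfolding eventually_at_topological
      proof (intro exI[of _ UNIV] conjI ballI impI)
        fix y assume "y \<in> X"
        then show "norm (s y * f y) \<le> \<bar>s y\<bar>"
          using bd[of y] mult_left_le[of "\<bar>f y\<bar>" "\<bar>s y\<bar>"]
          by (cases "s y = 0") (auto simp: abs_mult)
      qed auto
      show "((\<lambda>y. \<bar>s y\<bar>) \<longlongrightarrow> 0) (at x within X)"
        using tendsto_rabs[OF sx] True by simp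
    qed
    then show ?thesis using True by simp
  next
    case False
    let ?X = "{x \<in> X. s x \<noteq> 0}"
    have "\<forall>\<^sub>F y in at x within X. s y \<noteq> 0"
      using tendsto_imp_eventually_ne[OF sx False] .
    then obtain O' where O: "open O'" "x \<in> O'" "\<And>y. y \<in> O' \<Longrightarrow> y \<noteq> x \<Longrightarrow> y \<in> X \<Longrightarrow> s y \<noteq> 0"
      unfolding eventually_at_topological by blast
    have "at x within X = at x within ?X"
      by (rule at_within_nhd[OF O(2,1)]) (use O(3) in auto)
    moreover have "(f \<longlongrightarrow> f x) (at x within ?X)"
      using f x False by (auto simp: continuous_on_def)
    ultimately show ?thesis
      using sx by (simp add: tendsto_mult)
  qed
qed

lemma compact_unit_cube: "compact {x :: 'b \<Rightarrow> real. \<forall>i. x i \<in> {0..1}}"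
proof -
  have "compactin (product_topology (\<lambda>i. euclideanreal) UNIV) (PiE UNIV (\<lambda>_::'b. {0..1::real}))"
    by (simp add: compactin_PiE)
  moreover have "PiE UNIV (\<lambda>_::'b. {0..1::real}) = {x. \<forall>i. x i \<in> {0..1}}"
    by (auto simp: PiE_def Pi_def)
  ultimately show ?thesis by (simp add: euclidean_product_topology)
qed

subsection \<open>A variational inequality on the cube\<close>

definition cube :: "nat \<Rightarrow> (nat \<Rightarrow> real) set" where
  "cube d = {x. (\<forall>i<d. 0 \<le> x i \<and> x i \<le> 1) \<and> (\<forall>i\<ge>d. x i = 0)}"

lemma compact_cube: "compact (cube d)"
proof -
  have "closed {x::nat \<Rightarrow> real. x i = 0}" for i
    by (intro closed_Collect_eq continuous_on_coordinate continuous_on_coord continuous_on_const)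
  then have "closed (\<Inter>i\<in>{d..}. {x::nat \<Rightarrow> real. x i = 0})"
    by blast
  moreover have "cube d = {x. \<forall>i. x i \<in> {0..1}} \<inter> (\<Inter>i\<in>{d..}. {x. x i = 0})"
  proof (intro set_eqI iffI)
    fix x :: "nat \<Rightarrow> real" assume x: "x \<in> cube d"
    have "x i \<in> {0..1}" for i
      using x by (cases "i < d") (auto simp: cube_def)
    with x show "x \<in> {x. \<forall>i. x i \<in> {0..1}} \<inter> (\<Inter>i\<in>{d..}. {x. x i = 0})"
      by (auto simp: cube_def)
  qed (auto simp: cube_def)
  ultimately show ?thesis
    using compact_Int_closed[OF compact_unit_cube] by simp
qed

text \<open>Equivalent to Brouwer's theorem.  It is derived from Kuhn's lemma on cubes of sequences
  because \<open>d\<close> is a term variable here, which rules out the versions for Euclidean space types.\<close>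

lemma cube_variational_inequality:
  fixes F :: "(nat \<Rightarrow> real) \<Rightarrow> nat \<Rightarrow> real"
  assumes F: "continuous_on (cube d) F"
  obtains y where "y \<in> cube d"
    and "\<And>i. i < d \<Longrightarrow> y i = 0 \<or> F y i \<ge> 0"
    and "\<And>i. i < d \<Longrightarrow> y i = 1 \<or> F y i \<le> 0"
proof -
  define sc where "sc p x = (\<lambda>i. if i < d then real (x i) / real p else 0)" for p and x :: "nat \<Rightarrow> nat"
  have sc_cube: "sc p x \<in> cube d" if "p > 0" "\<forall>i<d. x i \<le> p" for p x
    using that by (auto simp: sc_def cube_def)
  \<comment> \<open>On the cube, \<open>lo i\<close> and \<open>hi i\<close> vanish exactly where
    the two alternatives of the conclusion hold; being continuous, they carry these alternatives to
    limits.\<close>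
  define lo where "lo i z = min (z i) (max 0 (- F z i))" for i and z :: "nat \<Rightarrow> real"
  define hi where "hi i z = min (1 - z i) (max 0 (F z i))" for i and z :: "nat \<Rightarrow> real"
  have ex: "\<exists>q. (\<forall>i<d. q i < p) \<and> (\<forall>i<d. \<exists>r s. (\<forall>j<d. q j \<le> r j \<and> r j \<le> q j + 1) \<and>
      (\<forall>j<d. q j \<le> s j \<and> s j \<le> q j + 1) \<and> lo i (sc p r) = 0 \<and> hi i (sc p s) = 0)"
    if p: "p > 0" for p
  proof -
    \<comment> \<open>The values forced on opposite faces are the boundary conditions of Kuhn's
      lemma. Label 0 makes \<open>lo\<close> vanish and label 1 makes \<open>hi\<close> vanish, so a
      small cube carrying both labels in every direction yields both alternatives.\<close>
    define label where "label x i = (if x i = 0 then 0 else if x i = p then 1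
        else if F (sc p x) i > 0 then 0 else 1 :: nat)" for x i
    have l0: "lo i (sc p x) = 0" if "label x i = 0" "i < d" "\<forall>j<d. x j \<le> p" for x i
      using that p by (auto simp: label_def lo_def sc_def split: if_splits)
    have l1: "hi i (sc p x) = 0" if "label x i = 1" "i < d" "\<forall>j<d. x j \<le> p" for x i
      using that p by (auto simp: label_def hi_def sc_def split: if_splits)
    obtain q where q: "\<forall>i<d. q i < p"
      and rs: "\<forall>i<d. \<exists>r s. (\<forall>j<d. q j \<le> r j \<and> r j \<le> q j + 1) \<and>
          (\<forall>j<d. q j \<le> s j \<and> s j \<le> q j + 1) \<and> label r i \<noteq> label s i"
      using kuhn_lemma[of p d label] p unfolding label_def by (smt (verit) less_irrefl)
    have "\<exists>r s. (\<forall>j<d. q j \<le> r j \<and> r j \<le> q j + 1) \<and>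
      (\<forall>j<d. q j \<le> s j \<and> s j \<le> q j + 1) \<and> lo i (sc p r) = 0 \<and> hi i (sc p s) = 0" if i: "i < d" for i
    proof -
      obtain r s where r: "\<forall>j<d. q j \<le> r j \<and> r j \<le> q j + 1"
        and s: "\<forall>j<d. q j \<le> s j \<and> s j \<le> q j + 1" and ne: "label r i \<noteq> label s i"
        using rs i by blast
      have rp: "\<forall>j<d. r j \<le> p" and sp: "\<forall>j<d. s j \<le> p"
        using r s q by fastforce+
      have "label r i = 0 \<and> label s i = 1 \<or> label r i = 1 \<and> label s i = 0"
        using ne p unfolding label_def by (smt (verit))
      then show ?thesis
        using l0 l1 r s rp sp i by blast
    qed
    then show ?thesis using q by blast
  qed
  have "\<exists>q. \<forall>n. (\<forall>i<d. q n i < Suc n) \<and>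
      (\<forall>i<d. \<exists>r s. (\<forall>j<d. q n j \<le> r j \<and> r j \<le> q n j + 1) \<and>
      (\<forall>j<d. q n j \<le> s j \<and> s j \<le> q n j + 1) \<and> lo i (sc (Suc n) r) = 0 \<and> hi i (sc (Suc n) s) = 0)"
    by (rule choice) (use ex in blast)
  then obtain q where q: "\<And>n i. i < d \<Longrightarrow> q n i < Suc n"
    and "\<forall>n i. i < d \<longrightarrow> (\<exists>r s. (\<forall>j<d. q n j \<le> r j \<and> r j \<le> q n j + 1) \<and>
      (\<forall>j<d. q n j \<le> s j \<and> s j \<le> q n j + 1) \<and> lo i (sc (Suc n) r) = 0 \<and> hi i (sc (Suc n) s) = 0)"
    by blast
  then obtain r s where r: "\<And>n i j. i < d \<Longrightarrow> j < d \<Longrightarrow> q n j \<le> r n i j \<and> r n i j \<le> q n j + 1"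
    and s: "\<And>n i j. i < d \<Longrightarrow> j < d \<Longrightarrow> q n j \<le> s n i j \<and> s n i j \<le> q n j + 1"
    and rlo: "\<And>n i. i < d \<Longrightarrow> lo i (sc (Suc n) (r n i)) = 0"
    and shi: "\<And>n i. i < d \<Longrightarrow> hi i (sc (Suc n) (s n i)) = 0"
    by metis
  have "\<forall>n. sc (Suc n) (q n) \<in> cube d"
    using q by (intro allI sc_cube) (auto simp: less_imp_le)
  with compact_imp_seq_compact[OF compact_cube]
  obtain y \<phi> where y: "y \<in> cube d" and \<phi>: "strict_mono (\<phi> :: nat \<Rightarrow> nat)"
    and lim: "((\<lambda>n. sc (Suc n) (q n)) \<circ> \<phi>) \<longlonglongrightarrow> y"
    unfolding seq_compact_def by meson
  \<comment> \<open>The witnesses depend on the direction \<open>i\<close>, but all of them stay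
    within one mesh width of \<open>q n\<close>, hence share the limit \<open>y\<close>.\<close>
  have near: "(\<lambda>n. sc (Suc (\<phi> n)) (t (\<phi> n))) \<longlonglongrightarrow> y"
    if t: "\<And>n j. j < d \<Longrightarrow> q n j \<le> t n j \<and> t n j \<le> q n j + 1" for t
    unfolding tendsto_coordinatewise
  proof
    fix j
    have a: "(\<lambda>n. sc (Suc (\<phi> n)) (q (\<phi> n)) j) \<longlonglongrightarrow> y j"
      using lim by (simp add: tendsto_coordinatewise o_def)
    have "(\<lambda>n. inverse (real (Suc (\<phi> n)))) \<longlonglongrightarrow> 0"
      using LIMSEQ_subseq_LIMSEQ[OF LIMSEQ_inverse_real_of_nat \<phi>] by (simp add: o_def)
    then have b: "(\<lambda>n. sc (Suc (\<phi> n)) (q (\<phi> n)) j + inverse (real (Suc (\<phi> n)))) \<longlonglongrightarrow> y j"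
      using tendsto_add[OF a] by fastforce
    have "sc (Suc n) (q n) j \<le> sc (Suc n) (t n) j"
      "sc (Suc n) (t n) j \<le> sc (Suc n) (q n) j + inverse (real (Suc n))" for n
    proof -
      show "sc (Suc n) (q n) j \<le> sc (Suc n) (t n) j"
        using t[of j n] by (auto simp: sc_def divide_right_mono)
      have "j < d \<Longrightarrow> real (t n j) / real (Suc n) \<le> (real (q n j) + 1) / real (Suc n)"
        using t[of j n] by (intro divide_right_mono) auto
      then show "sc (Suc n) (t n) j \<le> sc (Suc n) (q n) j + inverse (real (Suc n))"
        by (auto simp: sc_def inverse_eq_divide add_divide_distrib)
    qed
    then show "(\<lambda>n. sc (Suc (\<phi> n)) (t (\<phi> n)) j) \<longlonglongrightarrow> y j"
      by (intro tendsto_sandwich[OF _ _ a b]) auto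
  qed
  have zero: "f y = 0" if f: "continuous_on (cube d) f"
    and t: "\<And>n j. j < d \<Longrightarrow> q n j \<le> t n j \<and> t n j \<le> q n j + 1"
    and z: "\<And>n. f (sc (Suc n) (t n)) = 0" for f :: "(nat \<Rightarrow> real) \<Rightarrow> real" and t
  proof -
    have "t n i \<le> Suc n" if "i < d" for n i
      using t[OF that, of n] q[OF that, of n] by simp
    then have "(\<lambda>n. f (sc (Suc (\<phi> n)) (t (\<phi> n)))) \<longlonglongrightarrow> f y"
      by (intro continuous_on_tendsto_compose[OF f near[OF t] y] always_eventually allI sc_cube) auto
    then show ?thesis using z by (simp add: LIMSEQ_const_iff)
  qed
  have "continuous_on (cube d) (lo i)" "continuous_on (cube d) (hi i)" for i
    unfolding lo_def hi_def
    by (intro continuous_on_min continuous_on_max continuous_on_diff continuous_on_minus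
        continuous_on_const continuous_on_coordinate continuous_on_coord F)+
  then have z: "lo i y = 0" "hi i y = 0" if "i < d" for i
    using zero[of "lo i" "\<lambda>n. r n i"] zero[of "hi i" "\<lambda>n. s n i"] r s rlo shi that by simp_all
  have "y i = 0 \<or> F y i \<ge> 0" "y i = 1 \<or> F y i \<le> 0" if "i < d" for i
    using z[OF that] by (auto simp: lo_def hi_def min_def max_def split: if_splits)
  with y that show ?thesis by blast
qed

subsection \<open>Supports and realizations\<close>

abbreviation supp :: "('a \<Rightarrow> real) \<Rightarrow> 'a set" where
  "supp x \<equiv> {v. x v \<noteq> 0}"

lemma sum_supp:
  fixes x :: "'a \<Rightarrow> real"
  assumes "finite \<tau>" "supp x \<subseteq> \<tau>"
  shows "(\<Sum>v\<in>\<tau>. x v) = (\<Sum>v\<in>supp x. x v)"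
  using assms by (intro sum.mono_neutral_right) auto

lemma simplex_of_supp_iff:
  assumes "finite \<sigma>"
  shows "x \<in> simplex_of \<sigma> \<longleftrightarrow> (\<forall>v. 0 \<le> x v) \<and> supp x \<subseteq> \<sigma> \<and> (\<Sum>v\<in>supp x. x v) = 1"
proof -
  have "supp x \<subseteq> \<sigma> \<longleftrightarrow> (\<forall>v. v \<notin> \<sigma> \<longrightarrow> x v = 0)" by auto
  then show ?thesis
    using assms sum_supp[of \<sigma> x] by (metis simplex_of_iff)
qed

lemma realization_iff:
  assumes "abstract_simplicial_complex K"
  shows "x \<in> realization K \<longleftrightarrow> (\<forall>v. 0 \<le> x v) \<and> supp x \<in> K \<and> (\<Sum>v\<in>supp x. x v) = 1"
proof -
  have "x \<in> open_simplex \<sigma> \<longleftrightarrow> (\<forall>v. 0 \<le> x v) \<and> supp x = \<sigma> \<and> (\<Sum>v\<in>supp x. x v) = 1"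
    if "\<sigma> \<in> K" for \<sigma>
    using assms that simplex_of_supp_iff[of \<sigma> x]
    by (auto simp: open_simplex_def abstract_simplicial_complex_def)
  then show ?thesis by (auto simp: realization_def)
qed

text \<open>Open simplices make the carrier of a point unique; closed ones give the closed covers
  that compactness and gluing require.\<close>

lemma realization_eq_Union:
  assumes "abstract_simplicial_complex K"
  shows "realization K = (\<Union>\<sigma>\<in>K. simplex_of \<sigma>)"
proof (intro set_eqI iffI)
  fix x assume "x \<in> realization K"
  then show "x \<in> (\<Union>\<sigma>\<in>K. simplex_of \<sigma>)"
    by (auto simp: realization_def open_simplex_def)
next
  fix x assume "x \<in> (\<Union>\<sigma>\<in>K. simplex_of \<sigma>)"
  then obtain \<sigma> where "\<sigma> \<in> K" "x \<in> simplex_of \<sigma>" by blast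
  with assms show "x \<in> realization K"
    unfolding realization_iff[OF assms]
    by (auto simp: simplex_of_supp_iff abstract_simplicial_complex_def)
qed

lemma compact_simplex_of:
  assumes "finite \<sigma>"
  shows "compact (simplex_of \<sigma> :: ('a \<Rightarrow> real) set)"
proof -
  have c: "continuous_on UNIV (\<lambda>x::'a \<Rightarrow> real. x v)" for v
    by simp
  have "closed {x::'a \<Rightarrow> real. x v = 0}" for v
    by (intro closed_Collect_eq c continuous_on_const)
  then have 1: "closed (\<Inter>v\<in>-\<sigma>. {x::'a \<Rightarrow> real. x v = 0})" by blast
  have 2: "closed {x::'a \<Rightarrow> real. (\<Sum>v\<in>\<sigma>. x v) = 1}"
    by (intro closed_Collect_eq continuous_on_sum c continuous_on_const)
  have "simplex_of \<sigma> = {x. \<forall>v. x v \<in> {0..1}} \<inter>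
      ((\<Inter>v\<in>-\<sigma>. {x. x v = 0}) \<inter> {x. (\<Sum>v\<in>\<sigma>. x v) = 1})"
  proof (intro set_eqI iffI)
    fix x assume "x \<in> simplex_of \<sigma>"
    then have x: "\<forall>v. 0 \<le> x v" "\<forall>v. v \<notin> \<sigma> \<longrightarrow> x v = 0" "(\<Sum>v\<in>\<sigma>. x v) = 1"
      using assms by (auto simp: simplex_of_iff)
    moreover have "x v \<le> 1" for v
      using x member_le_sum[of v \<sigma> x] assms by (cases "v \<in> \<sigma>") auto
    ultimately show "x \<in> {x. \<forall>v. x v \<in> {0..1}} \<inter>
      ((\<Inter>v\<in>-\<sigma>. {x. x v = 0}) \<inter> {x. (\<Sum>v\<in>\<sigma>. x v) = 1})" by simp
  qed (use assms in \<open>auto simp: simplex_of_iff\<close>)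
  then show ?thesis
    using compact_Int_closed[OF compact_unit_cube closed_Int[OF 1 2]] by simp
qed

lemma closed_fun_compact:
  fixes S :: "('a \<Rightarrow> real) set"
  assumes "compact S"
  shows "closed S"
proof -
  have "Hausdorff_space (product_topology (\<lambda>_::'a. euclideanreal) UNIV)"
    by (simp add: Hausdorff_space_product_topology)
  then have "closedin euclidean S"
    using assms by (intro compactin_imp_closedin) (auto simp: euclidean_product_topology)
  then show ?thesis by simp
qed

lemma compact_realization:
  assumes "abstract_simplicial_complex K" "finite K"
  shows "compact (realization K)"
  using assms
  by (auto simp: realization_eq_Union abstract_simplicial_complex_def intro!: compact_UN compact_simplex_of)

subsection \<open>Radial projection away from the barycentre of a face\<close>

definition bary :: "'a set \<Rightarrow> 'a \<Rightarrow> real" where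
  "bary \<sigma> v = (if v \<in> \<sigma> then 1 / real (card \<sigma>) else 0)"

text \<open>For nonnegative \<open>x\<close>, the largest t for which x - t *
  \<open>bary \<sigma>\<close> is still nonnegative: the weight of the barycentre in a cone
  decomposition of \<open>x\<close>.\<close>

definition depth :: "'a set \<Rightarrow> ('a \<Rightarrow> real) \<Rightarrow> real" where
  "depth \<sigma> x = real (card \<sigma>) * Min (x ` \<sigma>)"

text \<open>The other point in the decomposition x = depth * bary + (1 - depth) * radial. At the
  barycentre the quotient is 0 by convention, which is not a point of any simplex.\<close>

definition radial :: "'a set \<Rightarrow> ('a \<Rightarrow> real) \<Rightarrow> 'a \<Rightarrow> real" where
  "radial \<sigma> x v = (x v - depth \<sigma> x * bary \<sigma> v) / (1 - depth \<sigma> x)"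

lemma continuous_on_depth:
  assumes "finite \<sigma>" "\<sigma> \<noteq> {}"
  shows "continuous_on X (depth \<sigma>)"
proof -
  have "continuous_on X (\<lambda>x. Min (x ` \<sigma>))"
    using assms
  proof (induction \<sigma> rule: finite_ne_induct)
    case (singleton v)
    then show ?case by (simp add: continuous_on_coordinate)
  next
    case (insert v \<sigma>)
    then show ?case by (auto intro!: continuous_on_min continuous_on_coordinate)
  qed
  then show ?thesis
    unfolding depth_def by (intro continuous_intros)
qed

lemma continuous_on_radial:
  assumes "finite \<sigma>" "\<sigma> \<noteq> {}" "\<And>x. x \<in> X \<Longrightarrow> depth \<sigma> x \<noteq> 1"
  shows "continuous_on X (radial \<sigma>)"
  unfolding radial_def using assms
  by (intro continuous_intros continuous_on_depth continuous_on_coordinate) auto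

context
  fixes \<sigma> \<tau> :: "'a set" and x :: "'a \<Rightarrow> real"
  assumes \<sigma>: "finite \<sigma>" "\<sigma> \<noteq> {}" and \<tau>: "finite \<tau>" and x: "x \<in> simplex_of \<tau>"
begin

lemma Min_image_le: "v \<in> \<sigma> \<Longrightarrow> Min (x ` \<sigma>) \<le> x v"
  using \<sigma> by simp

lemma depth_nonneg: "0 \<le> depth \<sigma> x"
proof -
  have "Min (x ` \<sigma>) \<in> x ` \<sigma>" using \<sigma> by (intro Min_in) auto
  then show ?thesis using x \<tau> by (auto simp: depth_def simplex_of_iff)
qed

lemma depth_eq_0: "\<not> \<sigma> \<subseteq> supp x \<Longrightarrow> depth \<sigma> x = 0"
proof -
  assume "\<not> \<sigma> \<subseteq> supp x"
  then obtain v where "v \<in> \<sigma>" "x v = 0" by auto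
  then have "Min (x ` \<sigma>) \<le> 0" using Min_image_le by metis
  then have "depth \<sigma> x \<le> 0" by (simp add: depth_def mult_nonneg_nonpos)
  then show ?thesis using depth_nonneg by simp
qed

lemma sum_union: "(\<Sum>v\<in>\<sigma> \<union> \<tau>. x v) = 1"
  using sum_supp[of "\<sigma> \<union> \<tau>" x] \<sigma> \<tau> x by (auto simp: simplex_of_supp_iff)

lemma sum_bary: "(\<Sum>v\<in>\<sigma> \<union> \<tau>. bary \<sigma> v) = 1"
proof -
  have "(\<Sum>v\<in>\<sigma> \<union> \<tau>. bary \<sigma> v) = (\<Sum>v\<in>\<sigma>. bary \<sigma> v)"
    using \<sigma> \<tau> by (intro sum.mono_neutral_right) (auto simp: bary_def)
  then show ?thesis using \<sigma> by (simp add: bary_def)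
qed

lemma depth_bary_le: "depth \<sigma> x * bary \<sigma> v \<le> x v"
  using Min_image_le[of v] \<sigma> x \<tau> by (auto simp: depth_def bary_def simplex_of_iff)

lemma depth_le_1: "depth \<sigma> x \<le> 1"
proof -
  have "(\<Sum>v\<in>\<sigma> \<union> \<tau>. depth \<sigma> x * bary \<sigma> v) \<le> (\<Sum>v\<in>\<sigma> \<union> \<tau>. x v)"
    by (intro sum_mono depth_bary_le)
  then show ?thesis by (simp add: sum_union sum_bary flip: sum_distrib_left)
qed

text \<open>Both functions have total weight 1 and one dominates the other pointwise.\<close>

lemma depth_eq_1: "depth \<sigma> x = 1 \<Longrightarrow> x = bary \<sigma>"
proof -
  assume d: "depth \<sigma> x = 1"
  have le: "0 \<le> x v - bary \<sigma> v" for v using depth_bary_le[of v] d by simp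
  have "(\<Sum>v\<in>\<sigma> \<union> \<tau>. x v - bary \<sigma> v) = 0"
    by (simp add: sum_subtractf sum_union sum_bary)
  then have "\<forall>v\<in>\<sigma> \<union> \<tau>. x v - bary \<sigma> v = 0"
    using sum_nonneg_eq_0_iff[of "\<sigma> \<union> \<tau>" "\<lambda>v. x v - bary \<sigma> v"] le \<sigma> \<tau> by simp
  moreover have "v \<notin> \<sigma> \<union> \<tau> \<Longrightarrow> x v = bary \<sigma> v" for v
    using x \<tau> by (simp add: simplex_of_iff bary_def)
  ultimately show "x = bary \<sigma>" by fastforce
qed

lemma radial_eq: "\<not> \<sigma> \<subseteq> supp x \<Longrightarrow> radial \<sigma> x = x"
  by (simp add: radial_def depth_eq_0 fun_eq_iff)

lemma radial_supp: "supp (radial \<sigma> x) \<subseteq> supp x"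
proof (cases "\<sigma> \<subseteq> supp x")
  case True
  then show ?thesis by (auto simp: radial_def bary_def)
qed (simp add: radial_eq)

text \<open>A vertex of \<sigma> where \<open>x\<close> is smallest loses all its weight.\<close>

lemma radial_not_supp: "\<not> \<sigma> \<subseteq> supp (radial \<sigma> x)"
proof -
  have "Min (x ` \<sigma>) \<in> x ` \<sigma>" using \<sigma> by (intro Min_in) auto
  then obtain v where "v \<in> \<sigma>" "x v = Min (x ` \<sigma>)" by auto
  then have "radial \<sigma> x v = 0" using \<sigma> by (simp add: radial_def bary_def depth_def)
  with \<open>v \<in> \<sigma>\<close> show ?thesis by auto
qed

lemma radial_simplex:
  assumes "depth \<sigma> x \<noteq> 1"
  shows "radial \<sigma> x \<in> simplex_of \<tau>"
proof -
  have d: "1 - depth \<sigma> x > 0" using assms depth_le_1 by simp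
  have "supp x \<subseteq> \<tau>" using x \<tau> by (simp add: simplex_of_supp_iff)
  then have s: "supp (radial \<sigma> x) \<subseteq> \<tau>" using radial_supp by blast
  have "(\<Sum>v\<in>\<sigma> \<union> \<tau>. radial \<sigma> x v) = 1"
    using d by (simp add: radial_def sum_union sum_bary sum_subtractf flip: sum_divide_distrib sum_distrib_left)
  then have "(\<Sum>v\<in>supp (radial \<sigma> x). radial \<sigma> x v) = 1"
    using sum_supp[of "\<sigma> \<union> \<tau>" "radial \<sigma> x"] \<sigma> \<tau> s by auto
  moreover have "0 \<le> radial \<sigma> x v" for v
    using depth_bary_le[of v] d by (simp add: radial_def)
  ultimately show ?thesis using s \<tau> by (simp add: simplex_of_supp_iff)
qed

end

lemma bary_simplex:
  assumes "finite \<sigma>" "\<sigma> \<noteq> {}"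
  shows "bary \<sigma> \<in> simplex_of \<sigma>"
  using assms by (auto simp: simplex_of_iff bary_def)

section \<open>Contraction of a punctured sphere\<close>

definition unit_sphere :: "nat \<Rightarrow> (nat \<Rightarrow> real) set" where
  "unit_sphere k = {x. (\<Sum>i\<le>k. (x i)\<^sup>2) = 1 \<and> (\<forall>i>k. x i = 0)}"

lemma nsphere_eq: "nsphere k = top_of_set (unit_sphere k)"
  by (simp add: nsphere unit_sphere_def euclidean_product_topology)

lemma sphere_coord_le_1:
  assumes "y \<in> unit_sphere k"
  shows "\<bar>y i\<bar> \<le> 1"
proof (cases "i \<le> k")
  case True
  have "(y i)\<^sup>2 \<le> (\<Sum>i\<le>k. (y i)\<^sup>2)"
    using True by (intro member_le_sum) auto
  then have "(y i)\<^sup>2 \<le> 1" using assms by (simp add: unit_sphere_def)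
  then show ?thesis by (simp add: abs_square_le_1)
qed (use assms in \<open>simp add: unit_sphere_def\<close>)

text \<open>The segment from y to -p meets the ray through p only if y = p: comparing norms in (1 -
  m) y = (c + m) p gives 1 - m = c + m. The case c = 0 allows the segment to be normalised, and c >
  0 shows that the normalised point is not p. At m = 1 only -p is left, so y may be p there.\<close>

lemma sphere_contraction_avoids:
  assumes "p \<in> unit_sphere k" "y \<in> unit_sphere k" "m \<le> 1" "m \<ge> 0" "m \<noteq> 1 \<Longrightarrow> y \<noteq> p" "c \<ge> 0"
  shows "(\<lambda>i. (1 - m) * y i - m * p i) \<noteq> (\<lambda>i. c * p i)"
proof
  assume eq: "(\<lambda>i. (1 - m) * y i - m * p i) = (\<lambda>i. c * p i)"
  then have e: "(1 - m) * y i = (c + m) * p i" for i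
    by (simp add: fun_eq_iff algebra_simps)
  have "(\<Sum>i\<le>k. ((1 - m) * y i)\<^sup>2) = (1 - m)\<^sup>2"
    using assms(2) by (simp add: unit_sphere_def power_mult_distrib flip: sum_distrib_left)
  moreover have "(\<Sum>i\<le>k. ((c + m) * p i)\<^sup>2) = (c + m)\<^sup>2"
    using assms(1) by (simp add: unit_sphere_def power_mult_distrib flip: sum_distrib_left)
  ultimately have "(1 - m)\<^sup>2 = (c + m)\<^sup>2" by (simp add: e)
  then have m: "1 - m = c + m" using assms by (simp add: power2_eq_iff_nonneg)
  then have "1 - m \<noteq> 0" using assms by auto
  then have "y = p" using e m by (auto simp: fun_eq_iff)
  then show False using assms(5) \<open>1 - m \<noteq> 0\<close> by auto
qed

definition sphere_proj :: "nat \<Rightarrow> (nat \<Rightarrow> real) \<Rightarrow> nat \<Rightarrow> real" where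
  "sphere_proj k w i = w i / sqrt (\<Sum>i\<le>k. (w i)\<^sup>2)"

lemma sphere_proj_sphere:
  assumes "w \<noteq> (\<lambda>i. 0)" "\<And>i. i > k \<Longrightarrow> w i = 0"
  shows "sphere_proj k w \<in> unit_sphere k" and "(\<Sum>i\<le>k. (w i)\<^sup>2) > 0"
proof -
  obtain i where "w i \<noteq> 0" using assms(1) by auto
  with assms(2) have "i \<le> k" by (meson not_le)
  have "(\<Sum>i\<le>k. (w i)\<^sup>2) \<noteq> 0"
    using \<open>i \<le> k\<close> \<open>w i \<noteq> 0\<close> by (subst sum_nonneg_eq_0_iff) auto
  moreover have "(\<Sum>i\<le>k. (w i)\<^sup>2) \<ge> 0" by (intro sum_nonneg) auto
  ultimately show pos: "(\<Sum>i\<le>k. (w i)\<^sup>2) > 0" by simp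
  then show "sphere_proj k w \<in> unit_sphere k"
    using assms(2) by (simp add: sphere_proj_def unit_sphere_def power_divide flip: sum_divide_distrib)
qed

text \<open>The sphere minus the image of the barycentre is contractible, so the identity of the boundary
  of \<open>\<sigma>\<close>, viewed as a map into the punctured sphere, extends over \<open>\<sigma>\<close>; the radial projection then
  pushes the extension off the interior of \<open>\<sigma>\<close>.\<close>

lemma sphere_facet_replacement:
  assumes S: "sphere_complex k S" and \<sigma>: "\<sigma> \<in> S" "\<sigma> \<noteq> {}"
    and max: "\<And>\<tau>. \<tau> \<in> S \<Longrightarrow> \<sigma> \<subseteq> \<tau> \<Longrightarrow> \<tau> = \<sigma>"
  obtains E where "continuous_on (simplex_of \<sigma>) E"
    and "\<And>x. x \<in> simplex_of \<sigma> \<Longrightarrow> E x \<in> realization (S - {\<sigma>})"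
    and "\<And>x. x \<in> simplex_of \<sigma> \<Longrightarrow> \<not> \<sigma> \<subseteq> supp x \<Longrightarrow> E x = x"
proof -
  have cplx: "abstract_simplicial_complex S"
    and hom: "realization_top S homeomorphic_space nsphere k"
    using S by (auto simp: sphere_complex_def)
  have fin: "finite \<tau>" if "\<tau> \<in> S" for \<tau>
    using cplx that by (simp add: abstract_simplicial_complex_def)
  note f\<sigma> = fin[OF \<sigma>(1)]
  have top: "realization_top S = top_of_set (realization S)"
    by (simp add: realization_top_def euclidean_product_topology)
  obtain h h' where "homeomorphic_maps (top_of_set (realization S)) (top_of_set (unit_sphere k)) h h'"
    using hom unfolding homeomorphic_space_def top nsphere_eq by blast
  then have h: "continuous_on (realization S) h" "\<And>x. x \<in> realization S \<Longrightarrow> h x \<in> unit_sphere k"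
    and h': "continuous_on (unit_sphere k) h'" "\<And>y. y \<in> unit_sphere k \<Longrightarrow> h' y \<in> realization S"
    and h'h: "\<And>x. x \<in> realization S \<Longrightarrow> h' (h x) = x"
    and hh': "\<And>y. y \<in> unit_sphere k \<Longrightarrow> h (h' y) = y"
    by (auto simp: homeomorphic_maps_def continuous_map_iff_continuous2)
  have sub: "simplex_of \<sigma> \<subseteq> realization S"
    using \<sigma> by (auto simp: realization_eq_Union[OF cplx])
  define p where "p = h (bary \<sigma>)"
  have b: "bary \<sigma> \<in> realization S" using bary_simplex[OF f\<sigma> \<sigma>(2)] sub by blast
  have p: "p \<in> unit_sphere k" using h(2)[OF b] by (simp add: p_def)
  have push: "radial \<sigma> x \<in> realization (S - {\<sigma>})"
    if x: "x \<in> realization S" and nb: "x \<noteq> bary \<sigma>" for x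
  proof -
    obtain \<tau> where \<tau>: "\<tau> \<in> S" "x \<in> simplex_of \<tau>"
      using x by (auto simp: realization_eq_Union[OF cplx])
    note c = f\<sigma> \<sigma>(2) fin[OF \<tau>(1)] \<tau>(2)
    have "depth \<sigma> x \<noteq> 1" using depth_eq_1[OF c] nb by blast
    then have r: "radial \<sigma> x \<in> simplex_of \<tau>" by (rule radial_simplex[OF c])
    then have s: "supp (radial \<sigma> x) \<subseteq> \<tau>" and fs: "finite (supp (radial \<sigma> x))"
      using fin[OF \<tau>(1)] finite_subset by (auto simp: simplex_of_supp_iff)
    have o: "radial \<sigma> x \<in> open_simplex (supp (radial \<sigma> x))"
      using r fs fin[OF \<tau>(1)] by (simp add: open_simplex_def simplex_of_supp_iff)
    have "supp (radial \<sigma> x) \<in> S - {\<sigma>}"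
      using s \<tau>(1) cplx radial_not_supp[OF c] by (auto simp: abstract_simplicial_complex_def)
    then show ?thesis
      unfolding realization_def
      using UN_I[where a = "supp (radial \<sigma> x)" and B = open_simplex] o by blast
  qed
  \<comment> \<open>Depth is the homotopy parameter: on the boundary of \<sigma> it is 0 and
    \<open>w x\<close> is \<open>h x\<close>; at the barycentre it is 1 and \<open>w x\<close> is
    -p. The radial lines in between become segments that avoid the ray through
    \<open>p\<close>.\<close>
  define w where "w x = (\<lambda>i. (1 - depth \<sigma> x) * h (radial \<sigma> x) i - depth \<sigma> x * p i)" for x
  define E where "E x = radial \<sigma> (h' (sphere_proj k (w x)))" for x
  have hr: "h (radial \<sigma> x) \<in> unit_sphere k" "h (radial \<sigma> x) \<noteq> p"
    "radial \<sigma> x \<in> realization S"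
    if x: "x \<in> simplex_of \<sigma>" and d: "depth \<sigma> x \<noteq> 1" for x
  proof -
    note c = f\<sigma> \<sigma>(2) f\<sigma> x
    show r: "radial \<sigma> x \<in> realization S" using radial_simplex[OF c d] sub by blast
    then show "h (radial \<sigma> x) \<in> unit_sphere k" by (rule h(2))
    have "bary \<sigma> \<noteq> radial \<sigma> x"
    proof
      assume "bary \<sigma> = radial \<sigma> x"
      moreover have "\<sigma> \<subseteq> supp (bary \<sigma>)" using f\<sigma> \<sigma>(2) by (auto simp: bary_def)
      ultimately show False using radial_not_supp[OF c] by simp
    qed
    then show "h (radial \<sigma> x) \<noteq> p"
      using h'h[OF r] h'h[OF b] unfolding p_def by metis
  qed
  have w: "w x \<noteq> (\<lambda>i. c * p i)" if x: "x \<in> simplex_of \<sigma>" and c: "c \<ge> 0" for x c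
  proof -
    note dd = f\<sigma> \<sigma>(2) f\<sigma> x
    \<comment> \<open>At the barycentre \<open>h (radial \<sigma> x)\<close> is a meaningless value
      with coefficient 0; \<open>p\<close> stands in for it as a point of the sphere.\<close>
    define y where "y = (if depth \<sigma> x = 1 then p else h (radial \<sigma> x))"
    have "w x = (\<lambda>i. (1 - depth \<sigma> x) * y i - depth \<sigma> x * p i)"
      by (auto simp: w_def y_def)
    moreover have "(\<lambda>i. (1 - depth \<sigma> x) * y i - depth \<sigma> x * p i) \<noteq> (\<lambda>i. c * p i)"
      using p hr[OF x] depth_le_1[OF dd] depth_nonneg[OF dd] c
      by (intro sphere_contraction_avoids[of _ k]) (auto simp: y_def)
    ultimately show ?thesis by simp
  qed
  have wk: "w x i = 0" if "x \<in> simplex_of \<sigma>" "i > k" for x i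
    using hr(1)[OF that(1)] p that by (cases "depth \<sigma> x = 1") (auto simp: w_def unit_sphere_def)
  have w0: "w x \<noteq> (\<lambda>i. 0)" if "x \<in> simplex_of \<sigma>" for x
    using w[OF that, of 0] by simp
  have nw: "sphere_proj k (w x) \<in> unit_sphere k" "(\<Sum>i\<le>k. (w x i)\<^sup>2) > 0" if "x \<in> simplex_of \<sigma>" for x
    using sphere_proj_sphere[OF w0[OF that], of k] wk that by auto
  have nwp: "sphere_proj k (w x) \<noteq> p" if x: "x \<in> simplex_of \<sigma>" for x
  proof
    assume "sphere_proj k (w x) = p"
    then have "w x = (\<lambda>i. sqrt (\<Sum>i\<le>k. (w x i)\<^sup>2) * p i)"
      using nw(2)[OF x] by (auto simp: sphere_proj_def)
    then show False using w[OF x, of "sqrt (\<Sum>i\<le>k. (w x i)\<^sup>2)"] nw(2)[OF x] by simp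
  qed
  have nb: "h' (sphere_proj k (w x)) \<in> realization S" "h' (sphere_proj k (w x)) \<noteq> bary \<sigma>"
    if x: "x \<in> simplex_of \<sigma>" for x
    using h'(2) nw(1)[OF x] hh'[OF nw(1)[OF x]] nwp[OF x] by (auto simp: p_def)
  have cw: "continuous_on (simplex_of \<sigma>) w"
  proof (rule continuous_on_coordinatewise_then_product)
    fix i
    have d: "continuous_on X (depth \<sigma>)" for X by (rule continuous_on_depth[OF f\<sigma> \<sigma>(2)])
    \<comment> \<open>Coordinates on the sphere are bounded by 1, so the vanishing coefficient
      \<open>1 - depth \<sigma> x\<close> takes care of the barycentre.\<close>
    have "continuous_on {x \<in> simplex_of \<sigma>. 1 - depth \<sigma> x \<noteq> 0} (\<lambda>x. h (radial \<sigma> x))"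
      using hr(3)
      by (intro continuous_on_compose2[OF h(1)] continuous_on_radial f\<sigma> \<sigma>(2)) auto
    then have "continuous_on (simplex_of \<sigma>) (\<lambda>x. (1 - depth \<sigma> x) * h (radial \<sigma> x) i)"
      using hr(1) sphere_coord_le_1
      by (intro continuous_on_scaled continuous_on_coord continuous_on_diff continuous_on_const d) auto
    then show "continuous_on (simplex_of \<sigma>) (\<lambda>x. w x i)"
      unfolding w_def by (rule continuous_on_diff) (intro continuous_on_mult continuous_on_const d)
  qed
  have cn: "continuous_on (simplex_of \<sigma>) (\<lambda>x. sphere_proj k (w x))"
  proof (rule continuous_on_coordinatewise_then_product)
    fix i
    show "continuous_on (simplex_of \<sigma>) (\<lambda>x. sphere_proj k (w x) i)"
      unfolding sphere_proj_def using nw(2)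
      by (intro continuous_on_divide continuous_on_real_sqrt continuous_on_sum continuous_on_power
          continuous_on_coord cw) (auto simp: less_imp_neq[symmetric])
  qed
  have "continuous_on (simplex_of \<sigma>) E"
    unfolding E_def
  proof (rule continuous_on_compose2[of "{x \<in> realization S. x \<noteq> bary \<sigma>}" "radial \<sigma>"])
    have "depth \<sigma> x \<noteq> 1" if "x \<in> realization S" "x \<noteq> bary \<sigma>" for x
      using that depth_eq_1[OF f\<sigma> \<sigma>(2)] fin by (auto simp: realization_eq_Union[OF cplx])
    then show "continuous_on {x \<in> realization S. x \<noteq> bary \<sigma>} (radial \<sigma>)"
      by (intro continuous_on_radial f\<sigma> \<sigma>(2)) auto
    show "continuous_on (simplex_of \<sigma>) (\<lambda>x. h' (sphere_proj k (w x)))"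
      using nw(1) by (intro continuous_on_compose2[OF h'(1) cn]) auto
  qed (use nb in auto)
  moreover have "E x \<in> realization (S - {\<sigma>})" if "x \<in> simplex_of \<sigma>" for x
    unfolding E_def by (rule push[OF nb[OF that]])
  moreover have "E x = x" if x: "x \<in> simplex_of \<sigma>" and ns: "\<not> \<sigma> \<subseteq> supp x" for x
  proof -
    note c = f\<sigma> \<sigma>(2) f\<sigma> x
    have xS: "x \<in> realization S" using x sub by blast
    have "w x = h x"
      by (simp add: w_def depth_eq_0[OF c ns] radial_eq[OF c ns])
    moreover have "sphere_proj k (h x) = h x"
      using h(2)[OF xS] by (simp add: sphere_proj_def unit_sphere_def fun_eq_iff)
    ultimately show ?thesis
      using h'h[OF xS] radial_eq[OF c ns] by (simp add: E_def)
  qed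
  ultimately show ?thesis using that by blast
qed

subsection \<open>Retraction onto a spanning tree\<close>

text \<open>Each missing face has its whole boundary in \<open>T\<close>, where its replacement map
  is the identity; so the replacements and the identity of |T| fit together along a finite closed
  cover.\<close>

lemma complex_retraction:
  assumes J: "abstract_simplicial_complex J" "finite J" and T: "abstract_simplicial_complex T" "T \<subseteq> J"
    and bd: "\<And>\<sigma> \<tau>. \<sigma> \<in> J - T \<Longrightarrow> \<tau> \<subset> \<sigma> \<Longrightarrow> \<tau> \<in> T"
    and max: "\<And>\<sigma> \<tau>. \<sigma> \<in> J - T \<Longrightarrow> \<tau> \<in> J \<Longrightarrow> \<sigma> \<subseteq> \<tau> \<Longrightarrow> \<tau> = \<sigma>"
    and sph: "\<And>\<sigma>. \<sigma> \<in> J - T \<Longrightarrow> \<exists>S. subcomplex S (T \<union> {\<sigma>}) \<and> sphere_complex k S"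
    and nosph: "\<not> (\<exists>S. subcomplex S T \<and> sphere_complex k S)"
  obtains r where "continuous_on (realization J) r"
    and "\<And>x. x \<in> realization J \<Longrightarrow> r x \<in> realization T"
    and "\<And>x. x \<in> realization T \<Longrightarrow> r x = x"
proof -
  have "\<exists>E. continuous_on (simplex_of \<sigma>) E \<and> (\<forall>x\<in>simplex_of \<sigma>. E x \<in> realization T) \<and>
      (\<forall>x\<in>simplex_of \<sigma>. \<not> \<sigma> \<subseteq> supp x \<longrightarrow> E x = x)" if \<sigma>: "\<sigma> \<in> J - T" for \<sigma>
  proof -
    obtain S where S: "subcomplex S (T \<union> {\<sigma>})" "sphere_complex k S" using sph[OF \<sigma>] by blast
    have "\<sigma> \<in> S" using S nosph by (auto simp: subcomplex_def)
    moreover have "\<sigma> \<noteq> {}" using \<sigma> T by (auto simp: abstract_simplicial_complex_def)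
    moreover have "\<tau> = \<sigma>" if "\<tau> \<in> S" "\<sigma> \<subseteq> \<tau>" for \<tau>
      using max[OF \<sigma>, of \<tau>] that S(1) T(2) by (auto simp: subcomplex_def)
    ultimately obtain E where E: "continuous_on (simplex_of \<sigma>) E"
      "\<And>x. x \<in> simplex_of \<sigma> \<Longrightarrow> E x \<in> realization (S - {\<sigma>})"
      "\<And>x. x \<in> simplex_of \<sigma> \<Longrightarrow> \<not> \<sigma> \<subseteq> supp x \<Longrightarrow> E x = x"
      using sphere_facet_replacement[OF S(2)] by metis
    have "realization (S - {\<sigma>}) \<subseteq> realization T"
      using S(1) by (auto simp: realization_def subcomplex_def)
    with E show ?thesis by blast
  qed
  then obtain E where E: "\<And>\<sigma>. \<sigma> \<in> J - T \<Longrightarrow> continuous_on (simplex_of \<sigma>) (E \<sigma>)"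
    and ET: "\<And>\<sigma> x. \<sigma> \<in> J - T \<Longrightarrow> x \<in> simplex_of \<sigma> \<Longrightarrow> E \<sigma> x \<in> realization T"
    and Eid: "\<And>\<sigma> x. \<sigma> \<in> J - T \<Longrightarrow> x \<in> simplex_of \<sigma> \<Longrightarrow> \<not> \<sigma> \<subseteq> supp x \<Longrightarrow> E \<sigma> x = x"
    by metis
  define r where "r x = (if supp x \<in> T then x else E (supp x) x)" for x
  have finJ: "finite \<sigma>" if "\<sigma> \<in> J" for \<sigma>
    using J that by (simp add: abstract_simplicial_complex_def)
  \<comment> \<open>\<open>r\<close> is defined by cases on supports; gluing over closed sets needs
    one formula on the whole closed simplex, boundary included.\<close>
  have rE: "r x = E \<sigma> x" if "\<sigma> \<in> J - T" "x \<in> simplex_of \<sigma>" for \<sigma> x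
  proof (cases "supp x = \<sigma>")
    case False
    have "supp x \<subseteq> \<sigma>" using that finJ by (simp add: simplex_of_supp_iff)
    then have "supp x \<subset> \<sigma>" using False by blast
    then show ?thesis using bd[OF that(1)] Eid[OF that] by (auto simp: r_def)
  qed (use that in \<open>simp add: r_def\<close>)
  have rT: "r x = x" if "x \<in> realization T" for x
    using that by (simp add: r_def realization_iff[OF T(1)])
  have cov: "realization J \<subseteq> \<Union>((\<lambda>\<sigma>. if \<sigma> \<in> T then realization T else simplex_of \<sigma>) ` J)"
    unfolding realization_eq_Union[OF J(1)] realization_eq_Union[OF T(1)] by auto
  have "continuous_on (\<Union>\<sigma>\<in>J. if \<sigma> \<in> T then realization T else simplex_of \<sigma>) r"
  proof (rule continuous_on_closed_Union[OF J(2)])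
    fix \<sigma> assume \<sigma>: "\<sigma> \<in> J"
    have "finite T" using J(2) T(2) finite_subset by blast
    then show "closed (if \<sigma> \<in> T then realization T else simplex_of \<sigma>)"
      using finJ[OF \<sigma>] by (simp add: closed_fun_compact compact_realization T compact_simplex_of)
    show "continuous_on (if \<sigma> \<in> T then realization T else simplex_of \<sigma>) r"
    proof (cases "\<sigma> \<in> T")
      case True
      have "continuous_on (realization T) r"
        by (rule iffD2[OF continuous_on_cong[OF refl rT] continuous_on_id])
      with True show ?thesis by simp
    next
      case False
      with \<sigma> have \<sigma>': "\<sigma> \<in> J - T" by blast
      have "continuous_on (simplex_of \<sigma>) r"
        by (rule iffD2[OF continuous_on_cong[OF refl rE[OF \<sigma>']] E[OF \<sigma>']])
      with False show ?thesis by simp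
    qed
  qed
  then have "continuous_on (realization J) r"
    using cov continuous_on_subset by blast
  moreover have "r x \<in> realization T" if x: "x \<in> realization J" for x
  proof -
    have sx: "supp x \<in> J" using x by (simp add: realization_iff[OF J(1)])
    have xs: "x \<in> simplex_of (supp x)"
      using x finJ[OF sx] by (simp add: simplex_of_supp_iff realization_iff[OF J(1)])
    show ?thesis
    proof (cases "supp x \<in> T")
      case True
      then show ?thesis
        using x rT by (simp add: realization_iff[OF J(1)] realization_iff[OF T(1)] r_def)
    next
      case False
      then show ?thesis using ET[of "supp x" x] sx xs by (simp add: r_def)
    qed
  qed
  ultimately show ?thesis using rT that by blast
qed

text \<open>For disjoint classes, the faces of their join. The first-order form, indexed by a set
  instead of a list, makes restriction to fewer vertices or fewer classes immediate.\<close>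

definition transversals :: "nat set \<Rightarrow> (nat \<Rightarrow> 'a set) \<Rightarrow> 'a set set" where
  "transversals I V = {\<sigma>. \<sigma> \<subseteq> (\<Union>i\<in>I. V i) \<and>
     (\<forall>i\<in>I. \<forall>v\<in>\<sigma>. \<forall>w\<in>\<sigma>. v \<in> V i \<longrightarrow> w \<in> V i \<longrightarrow> v = w)}"

lemma transversal_Int:
  "(\<forall>v\<in>\<sigma>. \<forall>w\<in>\<sigma>. v \<in> B \<longrightarrow> w \<in> B \<longrightarrow> v = w) \<longleftrightarrow> \<sigma> \<inter> B = {} \<or> (\<exists>v. \<sigma> \<inter> B = {v})"
proof
  assume *: "\<forall>v\<in>\<sigma>. \<forall>w\<in>\<sigma>. v \<in> B \<longrightarrow> w \<in> B \<longrightarrow> v = w"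
  show "\<sigma> \<inter> B = {} \<or> (\<exists>v. \<sigma> \<inter> B = {v})"
  proof (cases "\<sigma> \<inter> B = {}")
    case False
    then obtain v where "v \<in> \<sigma> \<inter> B" by blast
    with * have "\<sigma> \<inter> B = {v}" by blast
    then show ?thesis by blast
  qed simp
next
  assume "\<sigma> \<inter> B = {} \<or> (\<exists>v. \<sigma> \<inter> B = {v})"
  then obtain v where "\<sigma> \<inter> B \<subseteq> {v}" by blast
  then show "\<forall>v\<in>\<sigma>. \<forall>w\<in>\<sigma>. v \<in> B \<longrightarrow> w \<in> B \<longrightarrow> v = w" by blast
qed

lemma joins_eq_transversals:
  assumes "disjoint_family_on V {m..<n}"
  shows "joins (map (\<lambda>i. points_complex (V i)) [m..<n]) = transversals {m..<n} V"
proof -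
  have "V i \<inter> V j = {}" if "i \<in> set [m..<n]" "j \<in> set [m..<n]" "i \<noteq> j" for i j
    using assms that by (simp add: disjoint_family_on_def)
  then show ?thesis
    by (subst joins_points_complex[OF distinct_upt])
      (simp_all only: transversals_def transversal_Int set_upt)
qed

lemma transversals_mono: "\<sigma> \<in> transversals I V \<Longrightarrow> \<tau> \<subseteq> \<sigma> \<Longrightarrow> \<tau> \<in> transversals I V"
  unfolding transversals_def mem_Collect_eq
  by (intro conjI ballI impI) (blast, meson subsetD)

text \<open>Each class outside the missed set \<open>H\<close> contributes at most one vertex.
  \<open>H = {}\<close> bounds the dimension of the join; \<open>H = {k + 1}\<close> will put
  boundary points of the cube into the skeleton contained in \<open>T\<close>.\<close>

lemma card_transversal:
  assumes "finite I" "\<sigma> \<in> transversals I V" "H \<subseteq> I" "\<And>i. i \<in> H \<Longrightarrow> \<sigma> \<inter> V i = {}"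
  shows "card \<sigma> \<le> card (I - H)"
proof -
  have "\<sigma> = (\<Union>i\<in>I - H. \<sigma> \<inter> V i)"
    using assms(2,4) unfolding transversals_def by blast
  then have "card \<sigma> \<le> (\<Sum>i\<in>I - H. card (\<sigma> \<inter> V i))"
    using card_UN_le[of "I - H" "\<lambda>i. \<sigma> \<inter> V i"] assms(1) by simp
  also have "\<dots> \<le> (\<Sum>i\<in>I - H. 1)"
  proof (rule sum_mono)
    fix i assume "i \<in> I - H"
    then have "\<sigma> \<inter> V i = {} \<or> (\<exists>v. \<sigma> \<inter> V i = {v})"
      using assms(2) by (subst transversal_Int[symmetric]) (auto simp: transversals_def)
    then show "card (\<sigma> \<inter> V i) \<le> 1" by auto
  qed
  finally show ?thesis by simp
qed

lemma transversals_complex: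
  assumes "finite I" "\<And>i. i \<in> I \<Longrightarrow> finite (V i)"
  shows "abstract_simplicial_complex (transversals I V)" "finite (transversals I V)"
proof -
  have f: "finite (\<Union>i\<in>I. V i)" using assms by blast
  then have fin: "finite \<sigma>" if "\<sigma> \<in> transversals I V" for \<sigma>
    using that by (intro finite_subset[OF _ f]) (simp add: transversals_def)
  have e: "{} \<in> transversals I V" by (simp add: transversals_def)
  show "abstract_simplicial_complex (transversals I V)"
    unfolding abstract_simplicial_complex_def
    by (intro conjI ballI allI impI e) (fact fin, fact transversals_mono)
  have "transversals I V \<subseteq> Pow (\<Union>i\<in>I. V i)" by (auto simp: transversals_def)
  then show "finite (transversals I V)" using f finite_subset by blast
qed

text \<open>Since \<open>T\<close> contains all faces with at most k vertices (dimension at most k -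
  1), a missing face has exactly k + 1: it is a facet, and its proper faces belong to
  \<open>T\<close>.\<close>

lemma spanning_tree_retraction:
  assumes fin: "\<And>i. i \<in> {1..<k + 2} \<Longrightarrow> finite (V i)" and dj: "disjoint_family_on V {1..<k + 2}"
    and tree: "spanning_tree k V T"
  obtains r where "continuous_on (realization (transversals {1..<k + 2} V)) r"
    and "\<And>x. x \<in> realization (transversals {1..<k + 2} V) \<Longrightarrow> r x \<in> realization T"
    and "\<And>x. x \<in> realization T \<Longrightarrow> r x = x"
proof -
  let ?J = "transversals {1..<k + 2} V"
  have tr: "subcomplex T ?J" "\<forall>\<sigma>\<in>?J. face_dim \<sigma> \<le> int k - 1 \<longrightarrow> \<sigma> \<in> T"
    and nosph: "\<not> (\<exists>S. subcomplex S T \<and> sphere_complex k S)"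
    and uniq: "\<forall>\<sigma>. facet ?J \<sigma> \<and> \<sigma> \<notin> T \<longrightarrow>
      (\<exists>!S. subcomplex S (T \<union> {\<sigma>}) \<and> sphere_complex k S)"
    using tree[unfolded spanning_tree_def Let_def joins_eq_transversals[OF dj]] by blast+
  have T: "abstract_simplicial_complex T" "T \<subseteq> ?J"
    using tr(1) by (simp_all add: subcomplex_def)
  have skel: "\<sigma> \<in> T" if "\<sigma> \<in> ?J" "card \<sigma> \<le> k" for \<sigma>
    using tr(2) that by (simp add: face_dim_def)
  have sph: "\<exists>S. subcomplex S (T \<union> {\<sigma>}) \<and> sphere_complex k S" if "facet ?J \<sigma>" "\<sigma> \<notin> T" for \<sigma>
    using uniq that by (meson ex1_implies_ex)
  have J: "abstract_simplicial_complex ?J" "finite ?J"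
    using transversals_complex[of "{1..<k + 2}" V] fin by auto
  have finJ: "finite \<sigma>" if "\<sigma> \<in> ?J" for \<sigma>
    using J that by (simp add: abstract_simplicial_complex_def)
  have le: "card \<sigma> \<le> Suc k" if "\<sigma> \<in> ?J" for \<sigma>
    using card_transversal[OF _ that, of "{}"] by simp
  have max: "\<tau> = \<sigma>" if "\<sigma> \<in> ?J - T" "\<tau> \<in> ?J" "\<sigma> \<subseteq> \<tau>" for \<sigma> \<tau>
  proof -
    have "\<not> card \<sigma> \<le> k" using skel[of \<sigma>] that by blast
    then have "card \<tau> \<le> card \<sigma>" using le[OF that(2)] by linarith
    then show ?thesis using card_seteq[OF finJ[OF that(2)] that(3)] by simp
  qed
  show ?thesis
  proof (rule complex_retraction[OF J T _ max _ nosph that])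
    fix \<sigma> \<tau> assume a: "\<sigma> \<in> ?J - T" "\<tau> \<subset> \<sigma>"
    have "card \<tau> < card \<sigma>" using psubset_card_mono[OF finJ a(2)] a(1) by blast
    then have "card \<tau> \<le> k" using le[of \<sigma>] a(1) by simp
    moreover have "\<tau> \<in> ?J" using transversals_mono[of \<sigma>] a by blast
    ultimately show "\<tau> \<in> T" by (rule skel[rotated])
  next
    fix \<sigma> assume a: "\<sigma> \<in> ?J - T"
    have "facet ?J \<sigma>" using max[OF a] a unfolding facet_def by blast
    then show "\<exists>S. subcomplex S (T \<union> {\<sigma>}) \<and> sphere_complex k S" using sph a by blast
  qed
qed

section \<open>Extension of a retraction to a join\<close>

lemma realization_I:
  assumes "finite X" "supp x \<subseteq> X" "supp x \<in> K" "\<And>v. 0 \<le> x v" "(\<Sum>v\<in>X. x v) = 1"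
  shows "x \<in> realization K"
proof -
  have f: "finite (supp x)" using assms finite_subset by blast
  have "x \<in> simplex_of (supp x)"
    using assms f sum_supp[of X x] by (simp add: simplex_of_supp_iff)
  then have "x \<in> open_simplex (supp x)" by (simp add: open_simplex_def)
  then show ?thesis unfolding realization_def
    using UN_I[where a = "supp x" and B = open_simplex] assms(3) by blast
qed

lemma realization_le_1:
  assumes "abstract_simplicial_complex K" "x \<in> realization K"
  shows "x v \<le> 1"
proof (cases "x v = 0")
  case False
  have "finite (supp x)" "\<And>v. 0 \<le> x v" "(\<Sum>v\<in>supp x. x v) = 1"
    using assms by (auto simp: realization_iff[OF assms(1)] abstract_simplicial_complex_def)
  then show ?thesis using member_le_sum[of v "supp x" x] False by simp
qed simp

text \<open>A point of |K| is a convex combination of a part in \<open>U\<close> and a part off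
  \<open>U\<close>, of weights s and 1 - s; \<open>r\<close> acts on the normalised first part and
  the weights are kept. Through \<open>KJ\<close> and \<open>KL\<close> the complex \<open>K\<close>
  is accessed by restricting its faces, which suits transversals better than a literal join.\<close>

lemma retraction_join:
  assumes J: "abstract_simplicial_complex J" and T: "abstract_simplicial_complex T"
    and K: "abstract_simplicial_complex K" and U: "finite U" "\<Union>T \<subseteq> U"
    and KJ: "\<And>\<sigma>. \<sigma> \<in> K \<Longrightarrow> \<sigma> \<inter> U \<in> J" and KL: "\<And>\<sigma>. \<sigma> \<in> K \<Longrightarrow> \<sigma> - U \<in> L"
    and r: "continuous_on (realization J) r" "\<And>x. x \<in> realization J \<Longrightarrow> r x \<in> realization T"
      "\<And>x. x \<in> realization T \<Longrightarrow> r x = x"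
  obtains Q where "continuous_on (realization K) Q"
    and "\<And>x. x \<in> realization K \<Longrightarrow> Q x \<in> realization (complex_join T L)"
    and "\<And>x. x \<in> realization K \<Longrightarrow> supp x \<inter> U \<in> T \<Longrightarrow> Q x = x"
proof -
  define s where "s x = (\<Sum>v\<in>U. x v)" for x :: "'a \<Rightarrow> real"
  \<comment> \<open>Where \<open>s x = 0\<close> this is the zero function, not a point of |J|;
    \<open>Q\<close> multiplies the resulting value of \<open>r\<close> by 0.\<close>
  define n where "n x v = (if v \<in> U then x v / s x else 0)" for x v
  define Q where "Q x v = (if v \<in> U then s x * r (n x) v else x v)" for x v
  have Kx: "\<And>v. 0 \<le> x v" "supp x \<in> K" "finite (supp x)" "(\<Sum>v\<in>supp x. x v) = 1" "0 \<le> s x"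
    if "x \<in> realization K" for x
    using that K by (auto simp: realization_iff[OF K] abstract_simplicial_complex_def s_def intro: sum_nonneg)
  have suppn: "supp (n x) = supp x \<inter> U" if "s x \<noteq> 0" for x
    using that by (auto simp: n_def)
  have nreal: "n x \<in> realization M" if x: "x \<in> realization K" "s x \<noteq> 0" "supp x \<inter> U \<in> M" for x M
  proof (rule realization_I[OF U(1)])
    show "(\<Sum>v\<in>U. n x v) = 1"
      using x by (simp add: n_def flip: sum_divide_distrib s_def)
  qed (use suppn x Kx[OF x(1)] in \<open>auto simp: n_def\<close>)
  have nJ: "n x \<in> realization J" if "x \<in> realization K" "s x \<noteq> 0" for x
    using nreal KJ Kx that by blast
  note rn = r(2)[OF nJ]
  have s0: "x v = 0" if "x \<in> realization K" "s x = 0" "v \<in> U" for x v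
    using that U(1) Kx(1)[OF that(1)] by (simp add: s_def sum_nonneg_eq_0_iff)
  have cs: "continuous_on X s" for X
    unfolding s_def by (intro continuous_on_sum continuous_on_coordinate)
  have "continuous_on (realization K) Q"
  proof (rule continuous_on_coordinatewise_then_product)
    fix v
    have "continuous_on {x \<in> realization K. s x \<noteq> 0} n"
    proof (rule continuous_on_coordinatewise_then_product)
      fix w show "continuous_on {x \<in> realization K. s x \<noteq> 0} (\<lambda>x. n x w)"
        unfolding n_def by (cases "w \<in> U") (auto intro!: continuous_on_divide continuous_on_coordinate cs)
    qed
    then have "continuous_on {x \<in> realization K. s x \<noteq> 0} (\<lambda>x. r (n x))"
      using nJ by (intro continuous_on_compose2[OF r(1)]) auto
    moreover have "\<bar>r (n x) v\<bar> \<le> 1" if "x \<in> realization K" "s x \<noteq> 0" for x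
      using rn[OF that] realization_le_1[OF T rn[OF that]] by (simp add: realization_iff[OF T])
    ultimately have "continuous_on (realization K) (\<lambda>x. s x * r (n x) v)"
      by (intro continuous_on_scaled cs continuous_on_coord) auto
    then show "continuous_on (realization K) (\<lambda>x. Q x v)"
      unfolding Q_def by (cases "v \<in> U") (auto intro: continuous_on_coordinate)
  qed
  moreover have "Q x \<in> realization (complex_join T L)" if x: "x \<in> realization K" for x
  proof (rule realization_I[of "U \<union> supp x"])
    \<comment> \<open>The face of \<open>T\<close> that replaces \<open>supp x \<inter> U\<close>;
      without weight on \<open>U\<close> it has to be the empty face, whatever
      \<open>r (n x)\<close> is.\<close>
    define \<rho> where "\<rho> = (if s x = 0 then {} else supp (r (n x)))"
    have \<rho>: "\<rho> \<in> T"
      using T rn[OF x] by (auto simp: \<rho>_def realization_iff[OF T] abstract_simplicial_complex_def)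
    have "\<rho> \<subseteq> U" using \<rho> U(2) by blast
    then have "supp (Q x) = \<rho> \<union> (supp x - U)"
      by (auto simp: Q_def \<rho>_def)
    then show "supp (Q x) \<in> complex_join T L"
      using \<rho> KL[OF Kx(2)[OF x]] unfolding complex_join_def by blast
    show "finite (U \<union> supp x)" using U Kx[OF x] by simp
    show "supp (Q x) \<subseteq> U \<union> supp x" by (auto simp: Q_def)
    show "0 \<le> Q x v" for v
      using Kx[OF x] rn[OF x] by (cases "s x = 0") (auto simp: Q_def realization_iff[OF T])
    have "(\<Sum>v\<in>U. Q x v) = s x"
    proof (cases "s x = 0")
      case False
      have "(\<Sum>v\<in>U. r (n x) v) = 1"
        using rn[OF x False] sum_supp[OF U(1), of "r (n x)"] U by (auto simp: realization_iff[OF T])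
      then show ?thesis by (simp add: Q_def flip: sum_distrib_left)
    qed (simp add: Q_def)
    moreover have "(\<Sum>v\<in>supp x - U. Q x v) = (\<Sum>v\<in>supp x - U. x v)"
      by (intro sum.cong) (auto simp: Q_def)
    moreover have "(\<Sum>v\<in>U \<union> supp x. f v) = (\<Sum>v\<in>U. f v) + (\<Sum>v\<in>supp x - U. f v)" for f :: "'a \<Rightarrow> real"
      using sum.union_disjoint[of U "supp x - U" f] U Kx[OF x] by simp
    moreover have "(\<Sum>v\<in>U \<union> supp x. x v) = 1"
      using sum_supp[of "U \<union> supp x" x] U Kx[OF x] by simp
    ultimately show "(\<Sum>v\<in>U \<union> supp x. Q x v) = 1"
      by (simp add: s_def)
  qed
  moreover have "Q x = x" if x: "x \<in> realization K" "supp x \<inter> U \<in> T" for x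
  proof
    fix v
    show "Q x v = x v"
    proof (cases "s x = 0")
      case True
      then show ?thesis using s0[OF x(1)] by (simp add: Q_def)
    next
      case False
      have "r (n x) = n x" using r(3) nreal[OF x(1) False x(2)] .
      then show ?thesis using False by (simp add: Q_def n_def)
    qed
  qed
  ultimately show ?thesis using that by blast
qed

subsection \<open>A rainbow subdivision of the cube\<close>

definition grid_dist :: "real \<Rightarrow> real" where
  "grid_dist t = \<bar>t - of_int (round t)\<bar>"

lemma grid_dist_le_half: "grid_dist t \<le> 1 / 2"
  using of_int_round_abs_le[of t] by (simp add: grid_dist_def abs_minus_commute)

lemma grid_dist_lipschitz: "grid_dist s \<le> grid_dist t + \<bar>s - t\<bar>"
  using round_diff_minimal[of s "round t"] by (simp add: grid_dist_def)

lemma continuous_on_grid_dist: "continuous_on X grid_dist"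
proof -
  have "\<bar>grid_dist s - grid_dist t\<bar> \<le> \<bar>s - t\<bar>" for s t
    using grid_dist_lipschitz[of s t] grid_dist_lipschitz[of t s] by linarith
  then show ?thesis
    unfolding continuous_on_iff dist_real_def by (meson le_less_trans)
qed

lemma grid_dist_of_int: "grid_dist (of_int m) = 0"
  by (simp add: grid_dist_def)

lemma continuous_on_Min_insert:
  fixes f :: "'i \<Rightarrow> 'b::topological_space \<Rightarrow> real"
  assumes "finite F" "\<And>j. j \<in> F \<Longrightarrow> continuous_on X (f j)"
  shows "continuous_on X (\<lambda>y. Min (insert c ((\<lambda>j. f j y) ` F)))"
  using assms
proof (induction F rule: finite_induct)
  case (insert a F)
  have "Min (insert c ((\<lambda>j. f j y) ` insert a F)) = min (f a y) (Min (insert c ((\<lambda>j. f j y) ` F)))" for y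
    using insert.hyps(1) by (simp add: insert_commute[of c])
  then show ?case using insert by (auto intro!: continuous_on_min)
qed simp

lemma continuous_on_Max_insert:
  fixes f :: "'i \<Rightarrow> 'b::topological_space \<Rightarrow> real"
  assumes "finite F" "\<And>j. j \<in> F \<Longrightarrow> continuous_on X (f j)"
  shows "continuous_on X (\<lambda>y. Max (insert c ((\<lambda>j. f j y) ` F)))"
  using assms
proof (induction F rule: finite_induct)
  case (insert a F)
  have "Max (insert c ((\<lambda>j. f j y) ` insert a F)) = max (f a y) (Max (insert c ((\<lambda>j. f j y) ` F)))" for y
    using insert.hyps(1) by (simp add: insert_commute[of c])
  then show ?case using insert by (auto intro!: continuous_on_max)
qed simp

text \<open>Sort the distances of the coordinates of N y to the integers, with 0 in front and 1/2 at
  the end. The consecutive differences are the values at the initial segments \<open>I\<close> of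
  this order; every other \<open>I\<close> gets 0. They are half the barycentric coordinates of the
  subdivided grid.\<close>

definition gap :: "nat \<Rightarrow> nat \<Rightarrow> nat set \<Rightarrow> (nat \<Rightarrow> real) \<Rightarrow> real" where
  "gap d N I y = max 0 (Min (insert (1 / 2) ((\<lambda>j. grid_dist (real N * y j)) ` ({..<d} - I))) -
     Max (insert 0 ((\<lambda>j. grid_dist (real N * y j)) ` I)))"

lemma continuous_on_gap: "I \<subseteq> {..<d} \<Longrightarrow> continuous_on X (gap d N I)"
  unfolding gap_def using finite_subset[of I "{..<d}"]
  by (intro continuous_on_max continuous_on_diff continuous_on_const continuous_on_Min_insert
      continuous_on_Max_insert continuous_on_compose2[OF continuous_on_grid_dist[of UNIV]]
      continuous_on_mult continuous_on_coordinate) auto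

lemma gap_nonneg: "0 \<le> gap d N I y"
  by (simp add: gap_def)

lemma gap_pos_iff:
  assumes "I \<subseteq> {..<d}"
  shows "gap d N I y > 0 \<longleftrightarrow> (\<forall>i\<in>I. grid_dist (real N * y i) < 1 / 2) \<and>
    (\<forall>j\<in>{..<d} - I. 0 < grid_dist (real N * y j)) \<and>
    (\<forall>i\<in>I. \<forall>j\<in>{..<d} - I. grid_dist (real N * y i) < grid_dist (real N * y j))"
proof -
  have f: "finite I" using assms finite_subset by blast
  show ?thesis
    using f by (auto simp: gap_def less_max_iff_disj)
qed

text \<open>Both sets are initial segments of the same ordering by distance, hence nested; equal
  size settles it.\<close>

lemma gap_pos_unique:
  assumes I: "I \<subseteq> {..<d}" "I' \<subseteq> {..<d}" "gap d N I y > 0" "gap d N I' y > 0" "card I = card I'"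
  shows "I = I'"
proof -
  have f: "finite I" "finite I'" using I finite_subset by blast+
  have "I \<subseteq> I' \<or> I' \<subseteq> I"
  proof (rule ccontr)
    assume "\<not> ?thesis"
    then obtain i j where ij: "i \<in> I" "i \<notin> I'" "j \<in> I'" "j \<notin> I" by blast
    then have d: "i < d" "j < d" using I by auto
    have "grid_dist (real N * y i) < grid_dist (real N * y j)"
      using I(3) ij d by (auto simp: gap_pos_iff[OF I(1)])
    moreover have "grid_dist (real N * y j) < grid_dist (real N * y i)"
      using I(4) ij d by (auto simp: gap_pos_iff[OF I(2)])
    ultimately show False by simp
  qed
  then show ?thesis using f I(5) by (metis card_subset_eq)
qed

lemma gap_exists: "\<exists>I\<subseteq>{..<d}. gap d N I y > 0"
proof (intro exI conjI)
  \<comment> \<open>The last positive gap: every coordinate left out has the maximal distance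
    1/2.\<close>
  let ?I = "{j \<in> {..<d}. grid_dist (real N * y j) < 1 / 2}"
  show I: "?I \<subseteq> {..<d}" by blast
  have "grid_dist (real N * y j) = 1 / 2" if "j \<in> {..<d} - ?I" for j
    using that grid_dist_le_half[of "real N * y j"] by auto
  then show "gap d N ?I y > 0"
    unfolding gap_pos_iff[OF I] by auto
qed

text \<open>Where the gap is positive, this is the lower corner of the cell whose barycentre is
  meant. It is as good as the barycentre: constant nearby and within one mesh width of
  \<open>y\<close>.\<close>

definition grid_point :: "nat \<Rightarrow> nat \<Rightarrow> nat set \<Rightarrow> (nat \<Rightarrow> real) \<Rightarrow> nat \<Rightarrow> real" where
  "grid_point d N I y j = (if j < d then of_int (if j \<in> I then round (real N * y j)
     else \<lfloor>real N * y j\<rfloor>) / real N else 0)"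

lemma grid_point_near:
  assumes "N > 0" "j < d"
  shows "\<bar>y j - grid_point d N I y j\<bar> \<le> 1 / real N"
proof -
  define m where "m = (if j \<in> I then round (real N * y j) else \<lfloor>real N * y j\<rfloor>)"
  have "\<bar>real N * y j - of_int (round (real N * y j))\<bar> \<le> 1"
    using of_int_round_abs_le[of "real N * y j"] by linarith
  moreover have "\<bar>real N * y j - of_int \<lfloor>real N * y j\<rfloor>\<bar> \<le> 1" by linarith
  ultimately have "\<bar>real N * y j - of_int m\<bar> \<le> 1" by (simp add: m_def)
  then have "\<bar>real N * y j - of_int m\<bar> / real N \<le> 1 / real N"
    by (simp add: divide_right_mono)
  also have "\<bar>real N * y j - of_int m\<bar> / real N = \<bar>(real N * y j - of_int m) / real N\<bar>"
    by simp
  also have "(real N * y j - of_int m) / real N = y j - of_int m / real N"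
    using assms by (simp add: field_simps)
  finally show ?thesis using assms by (simp add: grid_point_def m_def)
qed

text \<open>A positive gap keeps the coordinates in \<open>I\<close> less than 1/2 from an integer
  and the others off the integers, and there \<open>round\<close> and floor do not jump. So even an
  \<open>f\<close> made by arbitrary choices is continuous along it.\<close>

lemma grid_point_locally_constant:
  assumes I: "I \<subseteq> {..<d}"
  shows "continuous_on {y \<in> X. gap d N I y \<noteq> 0} (\<lambda>y. f (grid_point d N I y) :: real)"
  unfolding continuous_on_def
proof
  fix y assume y: "y \<in> {y \<in> X. gap d N I y \<noteq> 0}"
  let ?F = "at y within {y \<in> X. gap d N I y \<noteq> 0}"
  have g: "gap d N I y > 0" using y gap_nonneg[of d N I y] by simp
  have lim: "((\<lambda>z. real N * z j) \<longlongrightarrow> real N * y j) ?F" for j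
    using continuous_on_coordinate[of "{y \<in> X. gap d N I y \<noteq> 0}" j] y
    by (auto simp: continuous_on_def intro!: tendsto_mult)
  have "\<forall>\<^sub>F z in ?F. grid_point d N I z j = grid_point d N I y j" if j: "j < d" for j
  proof (cases "j \<in> I")
    case True
    define m where "m = round (real N * y j)"
    have "\<bar>real N * y j - of_int m\<bar> < 1 / 2"
      using g True by (auto simp: gap_pos_iff[OF I] grid_dist_def m_def)
    then have "\<forall>\<^sub>F z in ?F. \<bar>real N * z j - of_int m\<bar> < 1 / 2"
      by (intro order_tendstoD(2)[OF tendsto_rabs[OF tendsto_diff[OF lim tendsto_const]]])
    then show ?thesis
    proof eventually_elim
      case (elim z)
      then have "round (real N * z j) = m" by (intro round_unique') auto
      then show ?case using True by (simp add: grid_point_def m_def)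
    qed
  next
    case False
    define m where "m = \<lfloor>real N * y j\<rfloor>"
    have "0 < grid_dist (real N * y j)"
      using g False j by (auto simp: gap_pos_iff[OF I])
    then have "real N * y j \<noteq> of_int m" using grid_dist_of_int[of m] by auto
    then have "of_int m < real N * y j" "real N * y j < of_int m + 1"
      unfolding m_def by linarith+
    then have "\<forall>\<^sub>F z in ?F. of_int m < real N * z j" "\<forall>\<^sub>F z in ?F. real N * z j < of_int m + 1"
      using order_tendstoD[OF lim[of j]] by auto
    then show ?thesis
    proof eventually_elim
      case (elim z)
      then have "\<lfloor>real N * z j\<rfloor> = m" by linarith
      then show ?case using False by (simp add: grid_point_def m_def)
    qed
  qed
  then have "\<forall>\<^sub>F z in ?F. \<forall>j\<in>{..<d}. grid_point d N I z j = grid_point d N I y j"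
    by (intro eventually_ball_finite) auto
  then have "\<forall>\<^sub>F z in ?F. f (grid_point d N I z) = f (grid_point d N I y)"
  proof eventually_elim
    case (elim z)
    have "grid_point d N I z j = grid_point d N I y j" for j
      using elim by (cases "j < d") (simp, simp add: grid_point_def)
    then have "grid_point d N I z = grid_point d N I y" by blast
    then show ?case by simp
  qed
  then show "((\<lambda>y. f (grid_point d N I y)) \<longlongrightarrow> f (grid_point d N I y)) ?F"
    by (rule tendsto_eventually)
qed

text \<open>The weights are barycentric coordinates in the barycentric subdivision of the cubical grid
  of mesh \<open>1 / N\<close>, and \<open>I\<close> is the set of directions orthogonal to a cell; colouring barycentres by
  \<open>card I\<close>, every simplex of the subdivision is rainbow, and colour \<open>0\<close> is absent from the
  boundary of the cube.\<close>

lemma rainbow_partition_of_unity: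
  assumes N: "N > 0"
  obtains lam :: "nat set \<Rightarrow> (nat \<Rightarrow> real) \<Rightarrow> real"
  where "\<And>I X. I \<subseteq> {..<d} \<Longrightarrow> continuous_on X (lam I)"
    and "\<And>I y. 0 \<le> lam I y"
    and "\<And>y. (\<Sum>I\<in>Pow {..<d}. lam I y) = 1"
    and "\<And>I I' y. I \<subseteq> {..<d} \<Longrightarrow> I' \<subseteq> {..<d} \<Longrightarrow> lam I y \<noteq> 0 \<Longrightarrow> lam I' y \<noteq> 0 \<Longrightarrow>
        card I = card I' \<Longrightarrow> I = I'"
    and "\<And>j y. j < d \<Longrightarrow> y j = 0 \<or> y j = 1 \<Longrightarrow> lam {} y = 0"
    and "\<And>I X f. I \<subseteq> {..<d} \<Longrightarrow>
        continuous_on {y \<in> X. lam I y \<noteq> 0} (\<lambda>y. f (grid_point d N I y) :: real)"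
proof -
  define tot where "tot y = (\<Sum>I\<in>Pow {..<d}. gap d N I y)" for y
  \<comment> \<open>The gaps sum to 1/2, but dividing by \<open>tot\<close> leaves only the
    positivity of the total to be shown.\<close>
  define lam where "lam I y = gap d N I y / tot y" for I y
  have tot: "tot y > 0" for y
  proof -
    obtain I where "I \<subseteq> {..<d}" "gap d N I y > 0" using gap_exists by blast
    then show ?thesis
      unfolding tot_def by (intro sum_pos2[of _ I]) (auto simp: gap_nonneg)
  qed
  have zero: "lam I y \<noteq> 0 \<longleftrightarrow> gap d N I y \<noteq> 0" for I y
    using tot[of y] by (simp add: lam_def)
  have pos: "gap d N I y > 0" if "lam I y \<noteq> 0" for I y
    using that gap_nonneg[of d N I y] by (simp add: zero)
  show ?thesis
  proof (rule that)
    show "continuous_on X (lam I)" if "I \<subseteq> {..<d}" for I X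
      unfolding lam_def
    proof (rule continuous_on_divide)
      show "continuous_on X tot"
        unfolding tot_def by (intro continuous_on_sum continuous_on_gap) auto
      show "\<forall>y\<in>X. tot y \<noteq> 0" using tot by (simp add: less_imp_neq[symmetric])
    qed (rule continuous_on_gap[OF that])
    show "0 \<le> lam I y" for I y
      using tot[of y] gap_nonneg[of d N I y] by (simp add: lam_def)
    show "(\<Sum>I\<in>Pow {..<d}. lam I y) = 1" for y
      using tot[of y] by (simp add: lam_def tot_def flip: sum_divide_distrib)
    show "I = I'" if "I \<subseteq> {..<d}" "I' \<subseteq> {..<d}" "lam I y \<noteq> 0" "lam I' y \<noteq> 0" "card I = card I'" for I I' y
      using gap_pos_unique[OF that(1,2) pos[OF that(3)] pos[OF that(4)] that(5)] .
    show "lam {} y = 0" if "j < d" "y j = 0 \<or> y j = 1" for j y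
    proof (rule ccontr)
      assume "lam {} y \<noteq> 0"
      then have "grid_dist (real N * y j) > 0"
        using pos that(1) gap_pos_iff[of "{}" d N y] by auto
      moreover have "grid_dist (real N * y j) = 0"
        using that(2) grid_dist_of_int[of 0] grid_dist_of_int[of "int N"] by auto
      ultimately show False by simp
    qed
    show "continuous_on {y \<in> X. lam I y \<noteq> 0} (\<lambda>y. f (grid_point d N I y) :: real)" if "I \<subseteq> {..<d}" for I X f
      unfolding zero by (rule grid_point_locally_constant[OF that])
  qed
qed

subsection \<open>Coloured maps of the cube\<close>

text \<open>0 is a combination of the points A v, v in \<open>C\<close>, with strictly positive
  weights, so they cannot all lie in the open half-space where the functional \<open>q\<close> is
  positive.\<close>

lemma colorful_vertex:
  assumes A: "affine_map (full_simplex W) d A" and W: "finite W" "C \<subseteq> W"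
    and zero: "(\<lambda>_. 0) \<in> face_image A C"
  shows "\<exists>v\<in>C. (\<Sum>j<d. q j * A (basis_vector v) j) \<le> 0"
proof (rule ccontr)
  assume neg: "\<not> ?thesis"
  obtain x where x: "x \<in> simplex_of C" "supp x = C" and Ax: "A x = (\<lambda>_. 0)"
    using zero by (auto simp: face_image_def open_simplex_def)
  have fC: "finite C" using W finite_subset by blast
  have "A x = (\<lambda>j. \<Sum>v\<in>C. x v * A (basis_vector v) j)"
    using A x(1) W(2) by (simp add: affine_map_def)
  then have "(\<Sum>v\<in>C. x v * A (basis_vector v) j) = 0" for j
    using Ax by (simp add: fun_eq_iff)
  then have "(\<Sum>j<d. q j * (\<Sum>v\<in>C. x v * A (basis_vector v) j)) = 0" by simp
  then have "(\<Sum>v\<in>C. x v * (\<Sum>j<d. q j * A (basis_vector v) j)) = 0"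
    by (simp add: sum_distrib_left sum.swap[of _ C] mult.left_commute)
  moreover have "(\<Sum>v\<in>C. x v * (\<Sum>j<d. q j * A (basis_vector v) j)) > 0"
  proof (rule sum_pos[OF fC])
    show "C \<noteq> {}" using x by (auto simp: simplex_of_def)
    fix v assume v: "v \<in> C"
    have "x v > 0"
      using x v fC by (auto simp: simplex_of_iff less_le)
    moreover have "(\<Sum>j<d. q j * A (basis_vector v) j) > 0" using neg v by force
    ultimately show "0 < x v * (\<Sum>j<d. q j * A (basis_vector v) j)" by simp
  qed
  ultimately show False by simp
qed

lemma sum_vertex_weights:
  fixes f :: "'a \<Rightarrow> real"
  assumes "finite X" "\<And>I. I \<in> P \<Longrightarrow> u I \<in> X"
  shows "(\<Sum>v\<in>X. (\<Sum>I\<in>P. c I * (if v = u I then 1 else 0)) * f v) = (\<Sum>I\<in>P. c I * f (u I))"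
proof -
  have "(\<Sum>v\<in>X. (\<Sum>I\<in>P. c I * (if v = u I then 1 else 0)) * f v) =
      (\<Sum>v\<in>X. \<Sum>I\<in>P. if v = u I then c I * f (u I) else 0)"
    by (auto simp: sum_distrib_right intro!: sum.cong)
  also have "\<dots> = (\<Sum>I\<in>P. \<Sum>v\<in>X. if v = u I then c I * f (u I) else 0)"
    by (rule sum.swap)
  also have "\<dots> = (\<Sum>I\<in>P. c I * f (u I))"
    using assms by (intro sum.cong) auto
  finally show ?thesis .
qed

text \<open>A cell with \<open>card I = c\<close> gives its weight to a vertex of
  \<open>V (col c)\<close>. Cells active at the same point differ in cardinality, so injectivity of
  \<open>col\<close> makes the support a transversal. The error \<open>e\<close> pays for choosing
  vertices at grid points instead of at \<open>y\<close>.\<close>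

lemma rainbow_map:
  fixes V :: "nat \<Rightarrow> 'a set" and a :: "'a \<Rightarrow> nat \<Rightarrow> real"
  assumes fin: "\<And>i. i \<in> C \<Longrightarrow> finite (V i)" "finite C" and dj: "disjoint_family_on V C"
    and col: "inj_on col {..d}" "col ` {..d} \<subseteq> C"
    and w: "\<And>i q. i \<in> C \<Longrightarrow> \<exists>v\<in>V i. (\<Sum>j<d. q j * a v j) \<le> 0"
    and e: "e > 0"
  obtains g where "continuous_on (cube d) g"
    and "\<And>y. y \<in> cube d \<Longrightarrow> g y \<in> realization (transversals C V)"
    and "\<And>y j. y \<in> cube d \<Longrightarrow> j < d \<Longrightarrow> y j = 0 \<or> y j = 1 \<Longrightarrow> supp (g y) \<inter> V (col 0) = {}"
    and "\<And>y. y \<in> cube d \<Longrightarrow>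
      (\<Sum>j<d. (y j - 1 / 2) * (\<Sum>v\<in>(\<Union>i\<in>C. V i). g y v * a v j)) \<le> e"
proof -
  define X where "X = (\<Union>i\<in>C. V i)"
  have fX: "finite X" using fin by (simp add: X_def)
  \<comment> \<open>\<open>B\<close> bounds the l1 norm of every vertex image, so
    \<open>B / real N\<close> bounds the effect of moving a point by one mesh width per
    coordinate.\<close>
  define B where "B = (\<Sum>v\<in>X. \<Sum>j<d. \<bar>a v j\<bar>)"
  have B: "B \<ge> 0" by (simp add: B_def sum_nonneg)
  obtain N where N: "N > 0" "B / real N \<le> e"
  proof -
    obtain n where n: "real n > B / e" using reals_Archimedean2 by blast
    have "B / e \<ge> 0" using B e by simp
    then have "n > 0" using n by (cases n) auto
    then have "B / real n \<le> e" using n e by (simp add: field_simps)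
    with \<open>n > 0\<close> show ?thesis using that by blast
  qed
  \<comment> \<open>The choice depends on the colour and the grid point only, and so inherits the
    local constancy of the latter.\<close>
  define wv where "wv c p = (SOME v. v \<in> V (col c) \<and> (\<Sum>j<d. (p j - 1 / 2) * a v j) \<le> 0)"
    for c and p :: "nat \<Rightarrow> real"
  have wv: "wv c p \<in> V (col c)" "(\<Sum>j<d. (p j - 1 / 2) * a (wv c p) j) \<le> 0" if "c \<le> d" for c p
  proof -
    have "col c \<in> C" using col(2) that by auto
    then have "\<exists>v. v \<in> V (col c) \<and> (\<Sum>j<d. (p j - 1 / 2) * a v j) \<le> 0"
      using w[of "col c" "\<lambda>j. p j - 1 / 2"] by blast
    from someI_ex[OF this] show "wv c p \<in> V (col c)" "(\<Sum>j<d. (p j - 1 / 2) * a (wv c p) j) \<le> 0"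
      by (auto simp: wv_def)
  qed
  obtain lam :: "nat set \<Rightarrow> (nat \<Rightarrow> real) \<Rightarrow> real"
    where lamc: "\<And>I X. I \<subseteq> {..<d} \<Longrightarrow> continuous_on X (lam I)"
    and lam0: "\<And>I y. 0 \<le> lam I y"
    and lam1: "\<And>y. (\<Sum>I\<in>Pow {..<d}. lam I y) = 1"
    and lamu: "\<And>I I' y. I \<subseteq> {..<d} \<Longrightarrow> I' \<subseteq> {..<d} \<Longrightarrow> lam I y \<noteq> 0 \<Longrightarrow> lam I' y \<noteq> 0 \<Longrightarrow>
        card I = card I' \<Longrightarrow> I = I'"
    and lamb: "\<And>j y. j < d \<Longrightarrow> y j = 0 \<or> y j = 1 \<Longrightarrow> lam {} y = 0"
    and laml: "\<And>I X f. I \<subseteq> {..<d} \<Longrightarrow>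
        continuous_on {y \<in> X. lam I y \<noteq> 0} (\<lambda>y. f (grid_point d N I y) :: real)"
    using rainbow_partition_of_unity[OF N(1), where d = d] by blast
  define u where "u I y = wv (card I) (grid_point d N I y)" for I y
  define g where "g y v = (\<Sum>I\<in>Pow {..<d}. lam I y * (if v = u I y then 1 else 0))" for y v
  have cardI: "card I \<le> d" if "I \<subseteq> {..<d}" for I
    using card_mono[OF _ that] by simp
  have uV: "u I y \<in> V (col (card I))" "col (card I) \<in> C" if "I \<subseteq> {..<d}" for I y
    using wv(1)[OF cardI[OF that]] col(2) cardI[OF that] by (auto simp: u_def)
  have uX: "u I y \<in> X" if "I \<in> Pow {..<d}" for I y
    using uV that by (auto simp: X_def)
  have gsum: "(\<Sum>v\<in>X. g y v * f v) = (\<Sum>I\<in>Pow {..<d}. lam I y * f (u I y))" for f y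
    unfolding g_def by (rule sum_vertex_weights[OF fX uX])
  have g0: "0 \<le> g y v" for y v
    unfolding g_def by (intro sum_nonneg mult_nonneg_nonneg lam0) auto
  have suppg: "\<exists>I\<subseteq>{..<d}. lam I y \<noteq> 0 \<and> v = u I y" if "g y v \<noteq> 0" for y v
  proof (rule ccontr)
    assume "\<not> ?thesis"
    then have "g y v = 0" unfolding g_def by (intro sum.neutral) auto
    with that show False by simp
  qed
  have color: "card I = c" if "I \<subseteq> {..<d}" "u I y \<in> V (col c)" "c \<le> d" for I y c
  proof -
    have cc: "col c \<in> C" using col(2) that(3) by auto
    have "u I y \<in> V (col (card I)) \<inter> V (col c)" using uV(1)[OF that(1)] that(2) by blast
    then have "col (card I) = col c"
      using dj uV(2)[OF that(1)] cc unfolding disjoint_family_on_def by blast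
    then show ?thesis using col(1) cardI[OF that(1)] that(3) by (auto simp: inj_on_def)
  qed
  show ?thesis
  proof (rule that)
    show "continuous_on (cube d) g"
    proof (rule continuous_on_coordinatewise_then_product)
      fix v
      have "continuous_on (cube d) (\<lambda>y. lam I y * (if v = u I y then 1 else 0))" if "I \<in> Pow {..<d}" for I
        unfolding u_def using that by (intro continuous_on_scaled lamc laml) auto
      then show "continuous_on (cube d) (\<lambda>y. g y v)"
        unfolding g_def by (intro continuous_on_sum)
    qed
    show "g y \<in> realization (transversals C V)" for y
    proof (rule realization_I[OF fX])
      show sub: "supp (g y) \<subseteq> X" using suppg uX by blast
      have "v = v'" if i: "i \<in> C" and v: "v \<in> supp (g y)" "v' \<in> supp (g y)" "v \<in> V i" "v' \<in> V i" for i v v'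
      proof -
        obtain I where I: "I \<subseteq> {..<d}" "lam I y \<noteq> 0" "v = u I y" using suppg v by blast
        obtain I' where I': "I' \<subseteq> {..<d}" "lam I' y \<noteq> 0" "v' = u I' y" using suppg v by blast
        have "v \<in> V (col (card I)) \<inter> V i" using uV(1)[OF I(1)] I(3) v by blast
        then have "i = col (card I)"
          using dj uV(2)[OF I(1)] i unfolding disjoint_family_on_def by blast
        then have "u I' y \<in> V (col (card I))" using v I' by simp
        then have "card I' = card I" using color[OF I'(1)] cardI[OF I(1)] by blast
        then have "I' = I" using lamu[OF I'(1) I(1) I'(2) I(2)] by blast
        then show ?thesis using I I' by simp
      qed
      then show "supp (g y) \<in> transversals C V"
        using sub unfolding transversals_def X_def by blast
      show "(\<Sum>v\<in>X. g y v) = 1" using gsum[of y "\<lambda>_. 1"] lam1[of y] by simp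
    qed (rule g0)
    show "supp (g y) \<inter> V (col 0) = {}" if "j < d" "y j = 0 \<or> y j = 1" for y j
    proof (rule ccontr)
      assume "supp (g y) \<inter> V (col 0) \<noteq> {}"
      then obtain v where v: "g y v \<noteq> 0" "v \<in> V (col 0)" by auto
      then obtain I where I: "I \<subseteq> {..<d}" "lam I y \<noteq> 0" "v = u I y" using suppg by blast
      then have "card I = 0" using color[OF I(1), of y 0] v by blast
      then have "I = {}" using I(1) finite_subset by fastforce
      then show False using lamb[of j y] that I by simp
    qed
    show "(\<Sum>j<d. (y j - 1 / 2) * (\<Sum>v\<in>(\<Union>i\<in>C. V i). g y v * a v j)) \<le> e" for y
      proof -
      have bound: "(\<Sum>j<d. (y j - 1 / 2) * a (u I y) j) \<le> B / real N" if I: "I \<in> Pow {..<d}" for I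
      proof -
        let ?p = "grid_point d N I y"
        have "(\<Sum>j<d. (y j - 1 / 2) * a (u I y) j) =
            (\<Sum>j<d. (y j - ?p j) * a (u I y) j) + (\<Sum>j<d. (?p j - 1 / 2) * a (u I y) j)"
          by (simp add: algebra_simps flip: sum.distrib)
        also have "(\<Sum>j<d. (?p j - 1 / 2) * a (u I y) j) \<le> 0"
          using wv(2)[OF cardI] I by (simp add: u_def)
        also have "(\<Sum>j<d. (y j - ?p j) * a (u I y) j) \<le> (\<Sum>j<d. 1 / real N * \<bar>a (u I y) j\<bar>)"
        proof (rule sum_mono)
          fix j assume "j \<in> {..<d}"
          then have "\<bar>y j - ?p j\<bar> * \<bar>a (u I y) j\<bar> \<le> 1 / real N * \<bar>a (u I y) j\<bar>"
            using grid_point_near[OF N(1), of j d y I] by (intro mult_right_mono) auto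
          then show "(y j - ?p j) * a (u I y) j \<le> 1 / real N * \<bar>a (u I y) j\<bar>"
            by (metis abs_ge_self abs_mult order_trans)
        qed
        also have "\<dots> = (\<Sum>j<d. \<bar>a (u I y) j\<bar>) / real N"
          by (simp add: sum_divide_distrib)
        also have "\<dots> \<le> B / real N"
          unfolding B_def using member_le_sum[of "u I y" X "\<lambda>v. \<Sum>j<d. \<bar>a v j\<bar>"] uX[OF I] fX
          by (intro divide_right_mono) (auto simp: sum_nonneg)
        finally show ?thesis by simp
      qed
      have "(\<Sum>j<d. (y j - 1 / 2) * (\<Sum>v\<in>X. g y v * a v j)) =
          (\<Sum>j<d. \<Sum>I\<in>Pow {..<d}. lam I y * ((y j - 1 / 2) * a (u I y) j))"
        by (simp add: gsum sum_distrib_left mult.left_commute)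
      also have "\<dots> = (\<Sum>I\<in>Pow {..<d}. lam I y * (\<Sum>j<d. (y j - 1 / 2) * a (u I y) j))"
        by (simp add: sum.swap[of _ "{..<d}"] sum_distrib_left)
      also have "\<dots> \<le> (\<Sum>I\<in>Pow {..<d}. lam I y * (B / real N))"
        by (intro sum_mono mult_left_mono bound lam0)
      also have "\<dots> = B / real N"
        using lam1[of y] by (simp flip: sum_distrib_right sum_divide_distrib)
      finally show ?thesis using N(2) unfolding X_def by linarith
    qed
  qed
qed

section \<open>The contradiction on the boundary of the cube\<close>

theorem theorem6:
  fixes d k :: nat and V :: "nat \<Rightarrow> 'a set" and T :: "'a set set"
    and A :: "('a \<Rightarrow> real) \<Rightarrow> nat \<Rightarrow> real"
  assumes "k \<le> d"
    and "\<And>i. i \<in> {1..d + 1} \<Longrightarrow> finite (V i)"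
    and "disjoint_family_on V {1..d + 1}"
    and "spanning_tree k V T"
    and "colorful_Caratheodory_map d V A"
  shows "\<exists>\<sigma> \<in> joins (T # map (\<lambda>i. points_complex (V i)) [k + 2..<d + 2]).
           (\<lambda>_. 0) \<in> face_image A \<sigma>"
proof (rule ccontr)
  assume neg: "\<not> ?thesis"
  let ?C = "{1..d + 1}" and ?J = "transversals {1..<k + 2} V" and ?L = "transversals {k + 2..<d + 2} V"
  let ?K = "transversals {1..d + 1} V"
  define X where "X = (\<Union>i\<in>?C. V i)"
  define U where "U = (\<Union>i\<in>{1..<k + 2}. V i)"
  define a where "a v j = A (basis_vector v) j" for v j
  have subJ: "{1..<k + 2} \<subseteq> ?C" and subL: "{k + 2..<d + 2} \<subseteq> ?C" using assms(1) by auto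
  have dJ: "disjoint_family_on V {1..<k + 2}" and dL: "disjoint_family_on V {k + 2..<d + 2}"
    using assms(3) subJ subL disjoint_family_on_mono by blast+
  have finJ: "\<And>i. i \<in> {1..<k + 2} \<Longrightarrow> finite (V i)" using assms(2) subJ by blast
  have fX: "finite X" and fU: "finite U" using assms(2) finJ by (auto simp: X_def U_def)
  have J: "abstract_simplicial_complex ?J" "finite ?J"
    using transversals_complex[of "{1..<k + 2}" V] finJ by auto
  have K: "abstract_simplicial_complex ?K" "finite ?K"
    using transversals_complex[of ?C V] assms(2) by auto
  have jn: "joins (T # map (\<lambda>i. points_complex (V i)) [k + 2..<d + 2]) = complex_join T ?L"
    using joins_eq_transversals[OF dL] by (simp add: joins_def)
  have aff: "affine_map (full_simplex X) d A" and zero: "\<And>i. i \<in> ?C \<Longrightarrow> (\<lambda>_. 0) \<in> face_image A (V i)"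
    using assms(5) by (auto simp: colorful_Caratheodory_map_def X_def)
  have tree: "abstract_simplicial_complex T" "T \<subseteq> ?J" "\<And>\<sigma>. \<sigma> \<in> ?J \<Longrightarrow> card \<sigma> \<le> k \<Longrightarrow> \<sigma> \<in> T"
    using assms(4)[unfolded spanning_tree_def Let_def joins_eq_transversals[OF dJ]]
    by (simp_all add: subcomplex_def face_dim_def)
  have TU: "\<Union>T \<subseteq> U" using tree(2) by (auto simp: transversals_def U_def)
  have KJ: "\<sigma> \<inter> U \<in> ?J" if "\<sigma> \<in> ?K" for \<sigma>
    using that subJ unfolding transversals_def U_def by blast
  have KL: "\<sigma> - U \<in> ?L" if "\<sigma> \<in> ?K" for \<sigma>
  proof -
    have "\<sigma> - U \<subseteq> (\<Union>i\<in>{k + 2..<d + 2}. V i)"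
    proof
      fix v assume v: "v \<in> \<sigma> - U"
      then obtain i where i: "i \<in> ?C" "v \<in> V i" using \<open>\<sigma> \<in> ?K\<close> by (auto simp: transversals_def)
      then have "i \<notin> {1..<k + 2}" using v by (auto simp: U_def)
      then have "i \<in> {k + 2..<d + 2}" using i by auto
      with i show "v \<in> (\<Union>i\<in>{k + 2..<d + 2}. V i)" by blast
    qed
    then show ?thesis using that subL unfolding transversals_def by blast
  qed
  obtain r where r: "continuous_on (realization ?J) r" "\<And>x. x \<in> realization ?J \<Longrightarrow> r x \<in> realization T"
    "\<And>x. x \<in> realization T \<Longrightarrow> r x = x"
    using spanning_tree_retraction[OF finJ dJ assms(4)] by blast
  obtain Q where Qc: "continuous_on (realization ?K) Q"
    and Q: "\<And>x. x \<in> realization ?K \<Longrightarrow> Q x \<in> realization (complex_join T ?L)"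
    and Qid: "\<And>x. x \<in> realization ?K \<Longrightarrow> supp x \<inter> U \<in> T \<Longrightarrow> Q x = x"
    using retraction_join[OF J(1) tree(1) K(1) fU TU KJ KL r] by blast
  \<comment> \<open>The affine formula for \<open>A\<close> over one fixed index set, which makes
    continuity visible on all faces at once.\<close>
  define h where "h x j = (\<Sum>v\<in>X. x v * a v j)" for x j
  \<comment> \<open>The l1 norm, because at the point \<open>y\<close> found below the pairing of
    \<open>F y\<close> with y - c is exactly half of it.\<close>
  define norm1 where "norm1 x = (\<Sum>j<d. \<bar>h (Q x) j\<bar>)" for x
  have norm1_pos: "norm1 x > 0" if x: "x \<in> realization ?K" for x
  proof -
    obtain \<sigma> where \<sigma>: "\<sigma> \<in> complex_join T ?L" "Q x \<in> open_simplex \<sigma>"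
      using Q[OF x] by (auto simp: realization_def)
    have "\<sigma> \<subseteq> X"
      using \<sigma>(1) TU subJ subL by (fastforce simp: complex_join_def transversals_def X_def U_def)
    then have f\<sigma>: "finite \<sigma>" using fX finite_subset by blast
    then have QX: "Q x \<in> simplex_of X"
      using \<sigma>(2) \<open>\<sigma> \<subseteq> X\<close> fX by (auto simp: open_simplex_def simplex_of_supp_iff)
    then have AQ: "A (Q x) = h (Q x)"
      using aff by (simp add: affine_map_def h_def a_def fun_eq_iff)
    have "Q x \<in> realization (full_simplex X)"
      using \<sigma>(2) \<open>\<sigma> \<subseteq> X\<close> by (auto simp: realization_def)
    then have high: "A (Q x) j = 0" if "j \<ge> d" for j
      using aff that by (auto simp: affine_map_def topspace_Euclidean_space)
    have "A (Q x) \<noteq> (\<lambda>_. 0)"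
      using neg \<sigma> unfolding jn face_image_def by (metis image_eqI)
    then obtain j where "A (Q x) j \<noteq> 0" by auto
    then have "j < d" "h (Q x) j \<noteq> 0" using high AQ by (auto simp: not_less[symmetric])
    then show ?thesis
      unfolding norm1_def by (intro sum_pos2[of _ j]) auto
  qed
  have hc: "continuous_on (realization ?K) (\<lambda>x. h (Q x) j)" for j
    unfolding h_def by (intro continuous_on_sum continuous_on_mult continuous_on_coord Qc continuous_on_const)
  have sc: "continuous_on (realization ?K) norm1"
    unfolding norm1_def by (intro continuous_on_sum continuous_on_rabs hc)
  \<comment> \<open>This bound has to precede \<open>g\<close>, whose mesh it dictates; 1 is a
    placeholder for an empty realization.\<close>
  obtain \<delta> where \<delta>: "\<delta> > 0" "\<And>x. x \<in> realization ?K \<Longrightarrow> \<delta> \<le> norm1 x"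
  proof (cases "realization ?K = {}")
    case True
    then show ?thesis using that[of 1] by simp
  next
    case False
    obtain x where "x \<in> realization ?K" "\<forall>y\<in>realization ?K. norm1 x \<le> norm1 y"
      using continuous_attains_inf[OF compact_realization[OF K] False sc] by blast
    then show ?thesis using that[of "norm1 x"] norm1_pos by blast
  qed
  \<comment> \<open>Colour \<open>0\<close>, absent from the boundary of the cube, stands for the class \<open>V (k + 1)\<close>: there the
    map has at most \<open>k\<close> vertices in the first \<open>k + 1\<close> classes and is therefore not moved by \<open>Q\<close>.\<close>
  define col where "col c = (if c = 0 then k + 1 else if c \<le> k then c else c + 1)" for c :: nat
  have col: "inj_on col {..d}" "col ` {..d} \<subseteq> ?C"
    using assms(1) by (auto simp: col_def inj_on_def split: if_splits)
  have w: "\<exists>v\<in>V i. (\<Sum>j<d. q j * a v j) \<le> 0" if "i \<in> ?C" for i q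
    unfolding a_def using that
    by (intro colorful_vertex[OF aff fX _ zero]) (auto simp: X_def)
  \<comment> \<open>\<open>\<delta> / 3\<close> is a positive number below
    \<open>\<delta> / 2\<close>, the lower bound that the same sum will have at
    \<open>y\<close>.\<close>
  obtain g where gc: "continuous_on (cube d) g"
    and gK: "\<And>y. y \<in> cube d \<Longrightarrow> g y \<in> realization ?K"
    and gb: "\<And>y j. y \<in> cube d \<Longrightarrow> j < d \<Longrightarrow> y j = 0 \<or> y j = 1 \<Longrightarrow> supp (g y) \<inter> V (col 0) = {}"
    and gs: "\<And>y. y \<in> cube d \<Longrightarrow> (\<Sum>j<d. (y j - 1 / 2) * (\<Sum>v\<in>(\<Union>i\<in>?C. V i). g y v * a v j)) \<le> \<delta> / 3"
    using rainbow_map[OF assms(2) _ assms(3) col w, of "\<delta> / 3"] \<delta>(1) by auto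
  define F where "F y j = h (Q (g y)) j" for y j
  have "continuous_on (cube d) F"
    unfolding F_def using gK
    by (intro continuous_on_coordinatewise_then_product continuous_on_compose2[OF hc gc]) auto
  then obtain y where y: "y \<in> cube d"
    and lo: "\<And>j. j < d \<Longrightarrow> y j = 0 \<or> F y j \<ge> 0" and hi: "\<And>j. j < d \<Longrightarrow> y j = 1 \<or> F y j \<le> 0"
    using cube_variational_inequality by blast
  have \<delta>F: "\<delta> \<le> (\<Sum>j<d. \<bar>F y j\<bar>)"
    using \<delta>(2)[OF gK[OF y]] by (simp add: norm1_def F_def)
  have "\<exists>j<d. F y j \<noteq> 0"
  proof (rule ccontr)
    assume "\<not> ?thesis"
    then have "(\<Sum>j<d. \<bar>F y j\<bar>) = 0" by (intro sum.neutral) auto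
    then show False using \<delta>F \<delta>(1) by simp
  qed
  \<comment> \<open>A nonzero \<open>F y j\<close> rules out one alternative in \<open>lo\<close> or
    in \<open>hi\<close>, which puts \<open>y\<close> on a face of the cube.\<close>
  then obtain j where j: "j < d" "y j = 0 \<or> y j = 1" using lo hi by force
  have "supp (g y) \<in> ?K" using gK[OF y] unfolding realization_iff[OF K(1)] by blast
  then have sJ: "supp (g y) \<inter> U \<in> ?J" by (rule KJ)
  have "supp (g y) \<inter> V (k + 1) = {}" using gb[OF y j] by (simp add: col_def)
  then have "card (supp (g y) \<inter> U) \<le> card ({1..<k + 2} - {k + 1})"
    by (intro card_transversal[OF _ sJ]) auto
  then have "supp (g y) \<inter> U \<in> T" by (intro tree(3) sJ) simp
  then have Qg: "Q (g y) = g y" using Qid[OF gK[OF y]] by blast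
  \<comment> \<open>A positive value forces \<open>y j = 1\<close> and a negative one
    \<open>y j = 0\<close>: the field points outward at \<open>y\<close>. Since \<open>Q\<close>
    fixes \<open>g y\<close>, the inequality for \<open>g\<close> applies to the same field and
    forbids this.\<close>
  have "(y j - 1 / 2) * F y j = \<bar>F y j\<bar> / 2" if "j < d" for j
    using lo[OF that] hi[OF that] by auto
  then have "(\<Sum>j<d. (y j - 1 / 2) * F y j) = (\<Sum>j<d. \<bar>F y j\<bar>) / 2"
    unfolding sum_divide_distrib by (intro sum.cong) auto
  moreover have "(\<Sum>j<d. (y j - 1 / 2) * F y j) \<le> \<delta> / 3"
    using gs[OF y] by (simp add: F_def Qg h_def X_def)
  ultimately show False using \<delta>F \<delta>(1) by simp
qed

end
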